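(* Suppose $n$ is not a prime number and $n=pq$ for some integers $p,q>1$. Let $\psi_1$ be a finite Blaschke product of order $p$ and let $\phi(z)=\psi_1(z^q)$. For $j=0,1,\dots,q-1$ let $\mathcal{M}_j=\operatorname{span}\{z^j,z^{q+j},z^{2q+j},\dots\}$ (closed linear span in the Dirichlet space $D$). Then each $\mathcal{M}_j$ is a reducing subspace of $M_\phi$ on $D$. Thus $M_\phi$ is reducible on $D$.
   Context: $\mathbb{D}=\{z\in\mathbb{C}:|z|<1\}$ and $dA$ is normalized Lebesgue area measure on $\mathbb{D}$. The Dirichlet space $D$ is the Hilbert space of holomorphic $f$ on $\mathbb{D}$ with $\int_{\mathbb{D}}|f'|^2dA<\infty$, with norm $\|f\|_D^2=\|f\|_{H^2}^2+\int_{\mathbb{D}}|f'|^2dA=\sum_{n\ge 0}(n+1)|\hat f(n)|^2$, where $\hat f(n)$ is the $n$-th Taylor coefficient and $H^2$ is the Hardy space. For $\lambda\in\mathbb{D}$, $\varphi_\lambda(z)=\frac{\lambda-z}{1-\overline{\lambda}z}$. A finite Blaschke product of order $n\ge1$ is a function $c\,\varphi_{\lambda_1}\cdots\varphi_{\lambda_n}$ with $\lambda_1,\dots,\lambda_n\in\mathbb{D}$ (not necessarily distinct) and $|c|=1$. $M_\phi f=\phi f$ is then a bounded operator on $D$. A closed subspace $\mathcal{M}$ of a Hilbert space is a reducing subspace of an operator $T$ if it is invariant under both $T$ and $T^*$; it is nontrivial if it is neither $\{0\}$ nor the whole space. $T$ is reducible if it has a nontrivial reducing subspace. *)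

theory Defs
  imports "HOL-Complex_Analysis.Complex_Analysis"
    "HOL-Computational_Algebra.Primes"
    "HOL-Library.Function_Algebras"
begin

global_interpretation cfun: vector_space "\<lambda>(c::complex) (f::complex \<Rightarrow> complex) z. c * f z"
  defines cfun_span = cfun.span
    and cfun_subspace = cfun.subspace
  by unfold_locales (auto simp: fun_eq_iff algebra_simps)

definition taylor_coeff :: "(complex \<Rightarrow> complex) \<Rightarrow> nat \<Rightarrow> complex" where
  "taylor_coeff f n = (deriv ^^ n) f 0 / fact n"

text \<open>Functions on the unit disc are represented by total functions that vanish off the disc,
  so that equality of elements is equality on the disc.\<close>

definition dirichlet_space :: "(complex \<Rightarrow> complex) set" where
  "dirichlet_space = {f. f holomorphic_on ball 0 1 \<and> (\<forall>z. z \<notin> ball 0 1 \<longrightarrow> f z = 0) \<and>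
     set_integrable lborel (ball 0 1) (\<lambda>z. (cmod (deriv f z))\<^sup>2)}"

text \<open>In the norm and in the inner product, the series is the Hardy space part;
  the factor \<open>1 / pi\<close> normalizes the area of the disc.\<close>

definition dirichlet_norm :: "(complex \<Rightarrow> complex) \<Rightarrow> real" where
  "dirichlet_norm f =
     sqrt ((\<Sum>n. (cmod (taylor_coeff f n))\<^sup>2) + (LINT z:ball 0 1|lborel. (cmod (deriv f z))\<^sup>2) / pi)"

definition dirichlet_inner :: "(complex \<Rightarrow> complex) \<Rightarrow> (complex \<Rightarrow> complex) \<Rightarrow> complex" where
  "dirichlet_inner f g =
     (\<Sum>n. taylor_coeff f n * cnj (taylor_coeff g n)) +
     (LINT z:ball 0 1|lborel. deriv f z * cnj (deriv g z)) / of_real pi"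

text \<open>\<^locale>\<open>Metric_space\<close> demands symmetry and nonnegativity of the distance also off the
  carrier, hence the case distinction.\<close>

definition dirichlet_dist :: "(complex \<Rightarrow> complex) \<Rightarrow> (complex \<Rightarrow> complex) \<Rightarrow> real" where
  "dirichlet_dist f g =
     (if f \<in> dirichlet_space \<and> g \<in> dirichlet_space then dirichlet_norm (f - g) else 0)"

definition dirichlet_topology :: "(complex \<Rightarrow> complex) topology" where
  "dirichlet_topology = Metric_space.mtopology dirichlet_space dirichlet_dist"

definition bounded_operator :: "((complex \<Rightarrow> complex) \<Rightarrow> complex \<Rightarrow> complex) \<Rightarrow> bool" where
  "bounded_operator T \<longleftrightarrow>
     T \<in> dirichlet_space \<rightarrow> dirichlet_space \<and>
     (\<forall>f\<in>dirichlet_space. \<forall>g\<in>dirichlet_space. T (f + g) = T f + T g) \<and>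
     (\<forall>c. \<forall>f\<in>dirichlet_space. T (\<lambda>z. c * f z) = (\<lambda>z. c * T f z)) \<and>
     (\<exists>C. \<forall>f\<in>dirichlet_space. dirichlet_norm (T f) \<le> C * dirichlet_norm f)"

definition is_adjoint ::
  "((complex \<Rightarrow> complex) \<Rightarrow> complex \<Rightarrow> complex) \<Rightarrow>
   ((complex \<Rightarrow> complex) \<Rightarrow> complex \<Rightarrow> complex) \<Rightarrow> bool" where
  "is_adjoint T S \<longleftrightarrow>
     S \<in> dirichlet_space \<rightarrow> dirichlet_space \<and>
     (\<forall>f\<in>dirichlet_space. \<forall>g\<in>dirichlet_space. dirichlet_inner (T f) g = dirichlet_inner f (S g))"

text \<open>The operator \<open>S\<close> below is the Hilbert space adjoint of \<open>T\<close>, which is unique on the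
  Dirichlet space.\<close>

definition reducing_subspace ::
  "((complex \<Rightarrow> complex) \<Rightarrow> complex \<Rightarrow> complex) \<Rightarrow> (complex \<Rightarrow> complex) set \<Rightarrow> bool" where
  "reducing_subspace T M \<longleftrightarrow>
     bounded_operator T \<and>
     M \<subseteq> dirichlet_space \<and> cfun_subspace M \<and> closedin dirichlet_topology M \<and>
     T ` M \<subseteq> M \<and> (\<exists>S. is_adjoint T S \<and> S ` M \<subseteq> M)"

definition reducible :: "((complex \<Rightarrow> complex) \<Rightarrow> complex \<Rightarrow> complex) \<Rightarrow> bool" where
  "reducible T \<longleftrightarrow> (\<exists>M. reducing_subspace T M \<and> M \<noteq> {0} \<and> M \<noteq> dirichlet_space)"

definition mult_op :: "(complex \<Rightarrow> complex) \<Rightarrow> (complex \<Rightarrow> complex) \<Rightarrow> complex \<Rightarrow> complex" where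
  "mult_op \<phi> f = (\<lambda>z. \<phi> z * f z)"

definition disc_monomial :: "nat \<Rightarrow> complex \<Rightarrow> complex" where
  "disc_monomial k = (\<lambda>z. if z \<in> ball 0 1 then z ^ k else 0)"

definition monomial_subspace :: "nat \<Rightarrow> nat \<Rightarrow> (complex \<Rightarrow> complex) set" where
  "monomial_subspace q j =
     dirichlet_topology closure_of cfun_span (range (\<lambda>k. disc_monomial (k * q + j)))"

definition disc_moebius :: "complex \<Rightarrow> complex \<Rightarrow> complex" where
  "disc_moebius a z = (a - z) / (1 - cnj a * z)"

text \<open>Only the values on the unit disc matter.\<close>

definition finite_blaschke_product :: "nat \<Rightarrow> (complex \<Rightarrow> complex) \<Rightarrow> bool" where
  "finite_blaschke_product n \<psi> \<longleftrightarrow> n \<ge> 1 \<and>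
     (\<exists>c a. cmod c = 1 \<and> (\<forall>i<n. a i \<in> ball 0 1) \<and>
       (\<forall>z\<in>ball 0 1. \<psi> z = c * (\<Prod>i<n. disc_moebius (a i) z)))"

end

theory Submission
  imports Defs
begin

text \<open>
  The decisive fact is a symmetry. With \<open>w = exp(2 \<pi> i / q)\<close>, the symbol \<open>\<phi>(z) = \<psi>\<^sub>1(z\<^sup>q)\<close>
  satisfies \<open>\<phi>(w z) = \<phi>(z)\<close>, so multiplication by \<open>\<phi>\<close> commutes with the rotation
  \<open>f \<mapsto> f(w \<cdot>)\<close>. The eigenspaces of this rotation are the spaces of functions whose Taylor
  coefficients are supported on one residue class modulo \<open>q\<close>
  (\<open>coefficient_subspace_iff_rotation\<close>), and these are the spaces \<open>\<M>\<^sub>j\<close>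
  (\<open>monomial_subspace_eq\<close>). Hence \<open>M\<^sub>\<phi>\<close> maps every \<open>\<M>\<^sub>j\<close> into itself. Since the \<open>\<M>\<^sub>j\<close> are
  pairwise orthogonal and each monomial lies in one of them, the adjoint preserves them as well
  (\<open>adjoint_preserves_coefficient_subspace\<close>). As \<open>q > 1\<close>, the space \<open>\<M>\<^sub>0\<close> contains \<open>1\<close> but not
  \<open>z\<close>, so it is a nontrivial reducing subspace.

  Everything on the Hilbert space side is done with Taylor coefficients. The bridge is Parseval's
  formula for area integrals, \<open>\<integral>\<bar>h\<bar>\<^sup>2 dA = \<Sum> \<bar>h\<^sub>n\<bar>\<^sup>2 / (n + 1)\<close> (\<open>disc_parseval\<close>). Applied to a
  derivative and polarized, it identifies the Dirichlet space with a weighted sequence space with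
  weights \<open>n + 1\<close> (\<open>dirichlet_space_iff\<close>, \<open>dirichlet_norm_sums\<close>, \<open>dirichlet_inner_sums\<close>), in which
  the adjoint of a bounded operator can be written down by its coefficients
  (\<open>bounded_operator_adjoint_exists\<close>). Finally, \<open>M\<^sub>\<phi>\<close> is bounded because a Blaschke product and its
  derivative are bounded on the disc (\<open>bounded_operator_mult_op\<close>).
\<close>

section \<open>Rotations and dilations of planar Lebesgue measure\<close>

text \<open>
  Through this identification of the plane with \<open>real^2\<close>, the determinant formula for the measure of
  linear images becomes available for multiplication by a complex number.
\<close>

lemma distr_lborel_complex_of_vector:
  "distr lborel borel (\<lambda>v::real^2. Complex (v $ 1) (v $ 2)) = (lborel :: complex measure)"
proof (rule lborel_eqI[symmetric])
  let ?J = "\<lambda>v::real^2. Complex (v $ 1) (v $ 2)"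
  have [measurable]: "?J \<in> borel_measurable borel"
    by (intro borel_measurable_continuous_onI) (auto simp: Complex_eq intro!: continuous_intros)
  fix l u :: complex
  assume lu: "\<And>b. b \<in> Basis \<Longrightarrow> l \<bullet> b \<le> u \<bullet> b"
  have "?J -` box l u = box (vector [Re l, Im l]) (vector [Re u, Im u])"
    by (simp add: set_eq_iff mem_box_cart forall_2) (auto simp: mem_box Basis_complex_def)
  moreover have "emeasure lborel (box (vector [Re l, Im l]) (vector [Re u, Im u]) :: (real^2) set)
      = (\<Prod>b\<in>Basis. (u - l) \<bullet> b)"
  proof -
    have "(\<Prod>b\<in>Basis. ((vector [Re u, Im u] :: real^2) - vector [Re l, Im l]) \<bullet> b)
       = (Re u - Re l) * (Im u - Im l)"
      by (simp add: Basis_vec_def UNION_singleton_eq_range prod.reindex inj_on_def axis_eq_axis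
          inner_axis prod_2 UNIV_2)
    moreover have "(\<Prod>b\<in>Basis. (u - l) \<bullet> b) = (Re u - Re l) * (Im u - Im l)"
      by (simp add: Basis_complex_def)
    moreover have "Re l \<le> Re u" "Im l \<le> Im u"
      using lu[of 1] lu[of \<i>] by (auto simp: Basis_complex_def)
    moreover have "(vector [Re l, Im l] :: real^2) $ x \<le> vector [Re u, Im u] $ x" for x
      using exhaust_2[of x] \<open>Re l \<le> Re u\<close> \<open>Im l \<le> Im u\<close> by auto
    ultimately show ?thesis
      by (subst emeasure_lborel_box) (auto simp: Basis_vec_def inner_axis)
  qed
  ultimately show "emeasure (distr lborel borel ?J) (box l u) = (\<Prod>b\<in>Basis. (u - l) \<bullet> b)"
    by (simp add: emeasure_distr)
qed auto

lemma distr_lborel_orthogonal: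
  fixes f :: "real^'n::{finite,wellorder} \<Rightarrow> real^'n::_"
  assumes f: "orthogonal_transformation f"
  shows "distr lborel borel f = lborel"
proof (rule lborel_eqI[symmetric])
  have [measurable]: "f \<in> borel_measurable borel"
    by (intro borel_measurable_continuous_onI linear_continuous_on)
      (simp add: f linear_conv_bounded_linear[symmetric] orthogonal_transformation_linear)
  fix l u :: "real^'n::_"
  assume lu: "\<And>b. b \<in> Basis \<Longrightarrow> l \<bullet> b \<le> u \<bullet> b"
  have inv: "orthogonal_transformation (inv f)" and bij: "bij f"
    using f by (auto intro: orthogonal_transformation_inv orthogonal_transformation_bij)
  have im: "f -` box l u = inv f ` box l u"
    by (simp add: bij bij_vimage_eq_inv_image)
  have meas: "f -` box l u \<in> sets borel"
    using measurable_sets[of f borel borel "box l u"] by simp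
  have "emeasure lborel (f -` box l u) = emeasure lebesgue (inv f ` box l u)"
    using meas by (simp add: im)
  also have "\<dots> = ennreal (measure lebesgue (inv f ` box l u))"
    by (intro emeasure_eq_measure2 measurable_orthogonal_image[OF inv]) auto
  also have "\<dots> = ennreal (measure lebesgue (box l u))"
    by (subst measure_orthogonal_image[OF inv]) auto
  also have "\<dots> = emeasure lborel (box l u)"
    using lu by (simp add: emeasure_lborel_box_eq)
  also have "\<dots> = (\<Prod>b\<in>Basis. (u - l) \<bullet> b)"
    using lu by (simp add: emeasure_lborel_box_eq)
  finally show "emeasure (distr lborel borel f) (box l u) = (\<Prod>b\<in>Basis. (u - l) \<bullet> b)"
    by (simp add: emeasure_distr)
qed auto

lemma distr_lborel_rotation:
  assumes w: "cmod w = 1"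
  shows "distr lborel borel (\<lambda>z. w * z) = (lborel :: complex measure)"
proof -
  define J where "J = (\<lambda>v::real^2. Complex (v $ 1) (v $ 2))"
  define R where "R = (\<lambda>v. vector [Re (w * J v), Im (w * J v)] :: real^2)"
  have J[measurable]: "J \<in> borel_measurable borel"
    unfolding J_def
    by (intro borel_measurable_continuous_onI) (auto simp: Complex_eq intro!: continuous_intros)
  have norm_J: "cmod (J v) = norm v" for v
    by (simp add: J_def norm_vec_def L2_set_def cmod_def sum_2 UNIV_2)
  have JR: "J (R v) = w * J v" for v
    by (simp add: J_def R_def complex_eq_iff)
  have "linear R"
    by (intro linearI)
      (simp_all add: R_def J_def vec_eq_iff forall_2 algebra_simps)
  then have R: "orthogonal_transformation R"
    unfolding orthogonal_transformation
    by (metis JR norm_J norm_mult w mult_1)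
  have [measurable]: "R \<in> borel_measurable borel"
    by (intro borel_measurable_continuous_onI linear_continuous_on)
      (simp add: \<open>linear R\<close> linear_conv_bounded_linear[symmetric])
  have "distr lborel borel (\<lambda>z. w * z) = distr (distr lborel borel J) borel (\<lambda>z. w * z)"
    by (simp add: J_def distr_lborel_complex_of_vector)
  also have "\<dots> = distr lborel borel (\<lambda>v. J (R v))"
    by (simp add: distr_distr comp_def JR)
  also have "\<dots> = distr (distr lborel borel R) borel J"
    by (simp add: distr_distr comp_def)
  also have "\<dots> = lborel"
    by (simp add: distr_lborel_orthogonal[OF R]) (simp add: J_def distr_lborel_complex_of_vector)
  finally show ?thesis .
qed

lemma nn_integral_ball_scale:
  fixes f :: "complex \<Rightarrow> ennreal"
  assumes [measurable]: "f \<in> borel_measurable borel" and r: "r > 0"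
  shows "(\<integral>\<^sup>+z\<in>ball 0 r. f z \<partial>lborel) = ennreal (r\<^sup>2) * (\<integral>\<^sup>+z\<in>ball 0 1. f (of_real r * z) \<partial>lborel)"
proof -
  have [measurable]: "ball 0 r \<in> sets (borel :: complex measure)"
    by simp
  have "(\<integral>\<^sup>+z\<in>ball 0 r. f z \<partial>lborel)
     = (\<integral>\<^sup>+z\<in>ball 0 r. f z \<partial>density (distr lborel borel (\<lambda>x. 0 + r *\<^sub>R x)) (\<lambda>_. \<bar>r\<bar>^DIM(complex)))"
    using r by (subst lborel_affine[of r 0]) auto
  also have "\<dots> = (\<integral>\<^sup>+z. ennreal (r\<^sup>2) * (f (r *\<^sub>R z) * indicator (ball 0 r) (r *\<^sub>R z)) \<partial>lborel)"
    using r by (simp add: nn_integral_density nn_integral_distr)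
  also have "\<dots> = ennreal (r\<^sup>2) * (\<integral>\<^sup>+z\<in>ball 0 1. f (of_real r * z) \<partial>lborel)"
    using r by (subst nn_integral_cmult)
      (auto simp: scaleR_conv_of_real indicator_def norm_mult intro!: arg_cong2[where f="(*)"] nn_integral_cong)
  finally show ?thesis .
qed

section \<open>Area integrals of power series\<close>

lemma set_integrable_disc_continuous:
  fixes f :: "complex \<Rightarrow> 'b::{banach, second_countable_topology}"
  assumes "continuous_on (cball 0 1) f"
  shows "set_integrable lborel (ball 0 1) f"
  using borel_integrable_compact[OF compact_cball assms]
  by (intro set_integrable_subset[of lborel "cball 0 1" f "ball 0 1"]) (auto simp: set_integrable_def)

text \<open>
  The rotation by \<open>w\<close> with \<open>w\<^sup>m\<^sup>-\<^sup>n = -1\<close> changes the sign of the integrand but not the integral.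
\<close>

lemma disc_monomials_orthogonal:
  assumes "m \<noteq> n"
  shows "(LINT z:ball 0 1|lborel. z ^ m * cnj (z ^ n)) = 0"
proof -
  define w where "w = cis (pi / (real m - real n))"
  define F where "F = (\<lambda>z::complex. indicator (ball 0 1) z *\<^sub>R (z ^ m * cnj (z ^ n)))"
  have "w ^ m * cnj (w ^ n) = cis (real m * (pi / (real m - real n)) + - (real n * (pi / (real m - real n))))"
    unfolding w_def by (simp only: Complex.DeMoivre cis_cnj cis_mult)
  also have "real m * (pi / (real m - real n)) + - (real n * (pi / (real m - real n)))
      = (real m - real n) * (pi / (real m - real n))"
    by (simp only: left_diff_distrib)
  also have "\<dots> = pi"
    using assms by simp
  finally have w: "w ^ m * cnj (w ^ n) = -1" by simp
  have [simp]: "cmod w = 1" by (simp add: w_def)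
  have F: "F (w * z) = - F z" for z
  proof -
    have "(w * z) ^ m * cnj ((w * z) ^ n) = (w ^ m * cnj (w ^ n)) * (z ^ m * cnj (z ^ n))"
      by (simp add: power_mult_distrib)
    then show ?thesis
      unfolding w by (simp add: F_def indicator_def norm_mult)
  qed
  have [measurable]: "ball 0 1 \<in> sets (borel :: complex measure)" by simp
  have [measurable]: "cnj \<in> borel_measurable borel"
    by (intro borel_measurable_continuous_onI continuous_intros)
  have [measurable]: "F \<in> borel_measurable borel"
    unfolding F_def by measurable
  have "integral\<^sup>L lborel F = integral\<^sup>L (distr lborel borel (\<lambda>z. w * z)) F"
    by (simp add: distr_lborel_rotation)
  also have "\<dots> = (LINT z|lborel. F (w * z))"
    by (rule integral_distr) auto
  also have "\<dots> = - integral\<^sup>L lborel F"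
    by (simp add: F)
  finally show ?thesis
    by (simp add: F_def set_lebesgue_integral_def)
qed

lemma emeasure_disc: "r \<ge> 0 \<Longrightarrow> emeasure lborel (ball (0::complex) r) = ennreal (pi * r\<^sup>2)"
  by (simp add: emeasure_ball unit_ball_vol_2)

text \<open>
  By scaling, the integral \<open>I\<close> over the unit disc determines the
  integral over the disc of radius \<open>r\<close>, which is \<open>r\<^sup>2\<^sup>n\<^sup>+\<^sup>2 I\<close>. So the integral over the annulus between
  them is \<open>(1 - r\<^sup>2\<^sup>n\<^sup>+\<^sup>2) I\<close>. On the other hand it lies between \<open>r\<^sup>2\<^sup>n\<close> and \<open>1\<close> times the area
  \<open>\<pi> (1 - r\<^sup>2)\<close>. Division by \<open>1 - r\<^sup>2\<close> and the limit \<open>r \<rightarrow> 1\<close> give \<open>(n + 1) I = \<pi>\<close>.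
\<close>

lemma disc_monomial_square_integral:
  "(LINT z:ball 0 1|lborel. cmod z ^ (2 * n)) = pi / (real n + 1)"
proof -
  define I where "I = (LINT z:ball 0 1|lborel. cmod z ^ (2 * n))"
  define J where "J r = (\<integral>\<^sup>+z\<in>ball (0::complex) r. ennreal (cmod z ^ (2 * n)) \<partial>lborel)" for r
  have [measurable]: "ball 0 r \<in> sets (borel :: complex measure)" for r by simp
  have "set_integrable lborel (ball 0 1) (\<lambda>z::complex. cmod z ^ (2 * n))"
    by (intro set_integrable_disc_continuous continuous_intros)
  then have "(\<integral>\<^sup>+z. ennreal (indicator (ball 0 1) z *\<^sub>R cmod z ^ (2 * n)) \<partial>lborel) = ennreal I"
    unfolding I_def set_lebesgue_integral_def set_integrable_def
    by (intro nn_integral_eq_integral) auto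
  moreover have "ennreal (indicator (ball 0 1) z *\<^sub>R cmod z ^ (2 * n))
      = ennreal (cmod z ^ (2 * n)) * indicator (ball 0 1) z" for z :: complex
    by (auto simp: indicator_def)
  ultimately have J1: "J 1 = ennreal I"
    by (simp add: J_def)
  have I0: "I \<ge> 0"
    unfolding I_def set_lebesgue_integral_def by (intro integral_nonneg_AE) auto
  have bounds: "pi * s ^ n \<le> (\<Sum>i<Suc n. s ^ i) * I \<and> (\<Sum>i<Suc n. s ^ i) * I \<le> pi"
    if s: "0 < s" "s < 1" for s
  proof -
    define r where "r = sqrt s"
    have r: "0 < r" "r < 1" "r\<^sup>2 = s" using s by (auto simp: r_def)
    have "J r = ennreal s * (\<integral>\<^sup>+z\<in>ball 0 1. ennreal (cmod (of_real r * z) ^ (2 * n)) \<partial>lborel)"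
      unfolding J_def using r by (subst nn_integral_ball_scale) auto
    also have "(\<integral>\<^sup>+z\<in>ball 0 1. ennreal (cmod (of_real r * z) ^ (2 * n)) \<partial>lborel)
       = (\<integral>\<^sup>+z. ennreal (s ^ n) * (ennreal (cmod z ^ (2 * n)) * indicator (ball 0 1) z) \<partial>lborel)"
      using r s by (intro nn_integral_cong)
        (simp add: norm_mult power_mult_distrib power_mult ennreal_mult' mult.assoc)
    also have "\<dots> = ennreal (s ^ n) * J 1"
      unfolding J_def by (rule nn_integral_cmult) measurable
    finally have Jr: "J r = ennreal (s ^ Suc n * I)"
      using s I0 by (simp add: J1 ennreal_mult' mult.assoc)
    define A where "A = ball (0::complex) 1 - ball 0 r"
    have [measurable]: "A \<in> sets borel" by (simp add: A_def)
    define K where "K = (\<integral>\<^sup>+z\<in>A. ennreal (cmod z ^ (2 * n)) \<partial>lborel)"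
    have "J 1 = J r + K"
      unfolding J_def K_def
      using r by (subst nn_integral_add[symmetric])
        (auto simp: A_def indicator_def intro!: nn_integral_cong)
    then have eqK: "ennreal I = ennreal (s ^ Suc n * I) + K" by (simp add: J1 Jr)
    then obtain k where k: "K = ennreal k" "k \<ge> 0"
      by (cases K) auto
    from eqK k have "ennreal I = ennreal (s ^ Suc n * I + k)"
      using s I0 by (simp add: ennreal_plus[symmetric] del: ennreal_plus)
    then have Ik: "I = s ^ Suc n * I + k"
      using s I0 k by (subst (asm) ennreal_inj) auto
    have "emeasure lborel A = emeasure lborel (ball (0::complex) 1) - emeasure lborel (ball (0::complex) r)"
      unfolding A_def using r by (intro emeasure_Diff) (auto simp: emeasure_disc)
    also have "\<dots> = ennreal (pi * (1 - s))"
      using r s by (simp add: emeasure_disc ennreal_minus algebra_simps)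
    finally have emA: "emeasure lborel A = ennreal (pi * (1 - s))" .
    have "K \<le> (\<integral>\<^sup>+z. indicator A z \<partial>lborel)"
      unfolding K_def by (intro nn_integral_mono) (auto simp: indicator_def A_def intro!: power_le_one)
    then have k1: "k \<le> pi * (1 - s)"
      using s k by (simp add: emA)
    have le: "s ^ n \<le> cmod z ^ (2 * n)" if "z \<in> A" for z
    proof -
      have "r \<le> cmod z" using that by (simp add: A_def)
      then have "r ^ (2 * n) \<le> cmod z ^ (2 * n)" using r by (intro power_mono) auto
      then show ?thesis using r by (simp add: power_mult)
    qed
    have "(\<integral>\<^sup>+z. ennreal (s ^ n) * indicator A z \<partial>lborel) \<le> K"
      unfolding K_def using le by (intro nn_integral_mono) (auto simp: indicator_def)
    then have k2: "s ^ n * (pi * (1 - s)) \<le> k"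
      using s k by (simp add: nn_integral_cmult emA ennreal_mult'[symmetric])
    \<comment> \<open>The geometric sum turns the factor \<open>1 - s ^ Suc n\<close> into a multiple of the factor \<open>1 - s\<close> of the area.\<close>
    have k_eq: "k = (1 - s) * ((\<Sum>i<Suc n. s ^ i) * I)"
      using Ik by (simp only: mult.assoc[symmetric] one_diff_power_eq[symmetric]) (simp add: algebra_simps)
    show ?thesis
      using k1 k2 s unfolding k_eq
      by (simp add: mult.commute[of pi "1 - s"] mult.left_commute[of _ "1 - s"] mult.commute[of pi])
  qed
  have lim1: "((\<lambda>s. pi * s ^ n) \<longlongrightarrow> pi * 1 ^ n) (at_left 1)"
    by (intro tendsto_intros)
  have lim2: "((\<lambda>s. (\<Sum>i<Suc n. s ^ i) * I) \<longlongrightarrow> (\<Sum>i<Suc n. 1 ^ i) * I) (at_left 1)"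
    by (intro tendsto_intros)
  have ev: "eventually (\<lambda>s::real. 0 < s \<and> s < 1) (at_left 1)"
    by (rule eventually_at_leftI[of 0]) auto
  have "pi * 1 ^ n \<le> (\<Sum>i<Suc n. 1 ^ i) * I"
    by (rule tendsto_le[OF trivial_limit_at_left_real lim2 lim1])
      (rule eventually_mono[OF ev], use bounds in auto)
  moreover have "(\<Sum>i<Suc n. 1 ^ i) * I \<le> pi"
    by (rule tendsto_le[OF trivial_limit_at_left_real tendsto_const lim2])
      (rule eventually_mono[OF ev], use bounds in auto)
  ultimately have "(real n + 1) * I = pi"
    by (simp add: algebra_simps)
  then show ?thesis
    unfolding I_def[symmetric] by (simp add: field_simps)
qed

lemma disc_polynomial_parseval:
  "(LINT z:ball 0 1|lborel. (cmod (\<Sum>k<N. c k * z ^ k))\<^sup>2) = (\<Sum>k<N. pi * (cmod (c k))\<^sup>2 / (real k + 1))"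
proof -
  have int: "set_integrable lborel (ball 0 1) (\<lambda>z. c k * cnj (c l) * (z ^ k * cnj (z ^ l)))" for k l
    by (intro set_integrable_disc_continuous continuous_intros)
  have diag: "(LINT z:ball 0 1|lborel. z ^ k * cnj (z ^ l)) = (if k = l then of_real (pi / (real k + 1)) else 0)" for k l
  proof (cases "k = l")
    case True
    have "z ^ k * cnj (z ^ k) = of_real (cmod z ^ (2 * k))" for z
      by (simp only: complex_norm_square[symmetric] norm_power power_mult[symmetric] mult.commute)
    then have "(LINT z:ball 0 1|lborel. z ^ k * cnj (z ^ k))
      = of_real (LINT z:ball (0::complex) 1|lborel. cmod z ^ (2 * k))"
      by (simp only: set_integral_complex_of_real)
    then show ?thesis using True by (simp only: disc_monomial_square_integral if_True simp_thms)
  next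
    case False
    then show ?thesis by (simp only: disc_monomials_orthogonal if_False not_False_eq_True)
  qed
  have "complex_of_real (LINT z:ball 0 1|lborel. (cmod (\<Sum>k<N. c k * z ^ k))\<^sup>2)
     = (LINT z:ball 0 1|lborel. of_real ((cmod (\<Sum>k<N. c k * z ^ k))\<^sup>2))"
    by (simp only: set_integral_complex_of_real)
  also have "\<dots> = (LINT z:ball 0 1|lborel. (\<Sum>k<N. \<Sum>l<N. c k * cnj (c l) * (z ^ k * cnj (z ^ l))))"
    by (simp only: complex_norm_square cnj_sum sum_product) (simp add: mult_ac)
  also have "\<dots> = (\<Sum>k<N. \<Sum>l<N. c k * cnj (c l) * (LINT z:ball 0 1|lborel. z ^ k * cnj (z ^ l)))"
  proof -
    have "(LINT z:ball 0 1|lborel. (\<Sum>k<N. \<Sum>l<N. c k * cnj (c l) * (z ^ k * cnj (z ^ l))))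
      = (\<Sum>k<N. \<Sum>l<N. (LINT z:ball 0 1|lborel. c k * cnj (c l) * (z ^ k * cnj (z ^ l))))"
      unfolding set_lebesgue_integral_def scaleR_sum_right
      by (subst Bochner_Integration.integral_sum
          | rule refl sum.cong Bochner_Integration.integrable_sum
          | rule int[unfolded set_integrable_def])+
    then show ?thesis by (simp only: set_integral_mult_right)
  qed
  also have "\<dots> = (\<Sum>k<N. c k * cnj (c k) * of_real (pi / (real k + 1)))"
    unfolding diag by (simp add: if_distrib[where f="\<lambda>x. _ * x"] sum.delta cong: if_cong)
  also have "\<dots> = of_real (\<Sum>k<N. pi * (cmod (c k))\<^sup>2 / (real k + 1))"
    unfolding of_real_sum
    by (intro sum.cong refl) (simp add: complex_norm_square[symmetric] mult_ac)
  finally show ?thesis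
    using of_real_eq_iff by blast
qed

lemma taylor_sums:
  assumes "f holomorphic_on ball 0 1" "z \<in> ball 0 1"
  shows "(\<lambda>n. taylor_coeff f n * z ^ n) sums f z"
  using holomorphic_power_series[OF assms] by (simp add: taylor_coeff_def)

text \<open>
  The power series of the dilation converges absolutely on the closed disc, so the formula for
  polynomials passes to the limit by dominated convergence.
\<close>

lemma disc_dilation_parseval:
  assumes h: "h holomorphic_on ball 0 1" and r: "0 < r" "r < 1"
  shows "(\<integral>\<^sup>+z\<in>ball 0 1. ennreal ((cmod (h (of_real r * z)))\<^sup>2) \<partial>lborel)
    = (\<Sum>n. ennreal (pi * (cmod (taylor_coeff h n))\<^sup>2 * (r\<^sup>2) ^ n / (real n + 1)))"
proof -
  define c where "c n = taylor_coeff h n * of_real r ^ n" for n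
  define K where "K = (\<Sum>n. cmod (c n))"
  have "summable (\<lambda>n. taylor_coeff h n * of_real ((1 + r) / 2) ^ n)"
    by (intro sums_summable[OF taylor_sums[OF h]], simp only: mem_ball_0 norm_of_real) (use r in simp)
  then have summ: "summable (\<lambda>n. cmod (c n))"
    unfolding c_def by (rule powser_insidea, simp only: norm_of_real) (use r in simp)
  have conv: "(\<lambda>N. \<Sum>k<N. c k * z ^ k) \<longlonglongrightarrow> h (of_real r * z)" if "z \<in> ball 0 1" for z
  proof -
    have "cmod (of_real r * z) < 1 * 1"
      unfolding norm_mult using r that by (intro mult_strict_mono) auto
    then show ?thesis
      using taylor_sums[OF h, of "of_real r * z"]
      by (simp add: sums_def c_def power_mult_distrib mult_ac)
  qed
  have bound: "cmod (\<Sum>k<N. c k * z ^ k) \<le> K" if "z \<in> ball 0 1" for z N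
  proof -
    have "cmod (\<Sum>k<N. c k * z ^ k) \<le> (\<Sum>k<N. cmod (c k) * 1)"
      using that by (intro sum_norm_le) (auto simp: norm_mult norm_power intro!: mult_left_le power_le_one)
    also have "\<dots> \<le> K"
      unfolding K_def using summ by (auto intro: sum_le_suminf)
    finally show ?thesis .
  qed
  let ?F = "\<lambda>z. indicator (ball 0 1) z *\<^sub>R (cmod (h (of_real r * z)))\<^sup>2"
  let ?P = "\<lambda>N z. indicator (ball 0 1) z *\<^sub>R (cmod (\<Sum>k<N. c k * z ^ k))\<^sup>2"
  have [measurable]: "ball 0 1 \<in> sets (borel :: complex measure)" by simp
  have P[measurable]: "?P N \<in> borel_measurable lborel" for N by measurable
  have lim: "(\<lambda>N. ?P N z) \<longlonglongrightarrow> ?F z" for z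
    using conv[of z] by (auto simp: indicator_def intro!: tendsto_intros)
  then have F: "?F \<in> borel_measurable lborel"
    by (intro borel_measurable_LIMSEQ_metric[OF P]) auto
  have K: "integrable lborel (\<lambda>z::complex. indicator (ball 0 1) z *\<^sub>R K\<^sup>2)"
    using set_integrable_disc_continuous[of "\<lambda>_. K\<^sup>2"] by (auto simp: set_integrable_def)
  have le: "norm (?P N z) \<le> indicator (ball 0 1) z *\<^sub>R K\<^sup>2" for N z
    using bound[of z N] by (auto simp: indicator_def intro!: power_mono)
  have "integrable lborel ?F"
    by (rule integrable_dominated_convergence[where s="?P", OF F P K]) (use lim le in auto)
  moreover have "(\<lambda>N. integral\<^sup>L lborel (?P N)) \<longlonglongrightarrow> integral\<^sup>L lborel ?F"
    by (rule integral_dominated_convergence[where s="?P", OF F P K]) (use lim le in auto)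
  ultimately have F_int: "(\<integral>\<^sup>+z. ennreal (?F z) \<partial>lborel) = ennreal (integral\<^sup>L lborel ?F)"
    and "(\<lambda>N. \<Sum>k<N. pi * (cmod (c k))\<^sup>2 / (real k + 1)) \<longlonglongrightarrow> integral\<^sup>L lborel ?F"
    using disc_polynomial_parseval[of c] unfolding set_lebesgue_integral_def
    by (auto intro!: nn_integral_eq_integral)
  then have "(\<lambda>n. pi * (cmod (c n))\<^sup>2 / (real n + 1)) sums integral\<^sup>L lborel ?F"
    by (simp add: sums_def)
  then have "(\<Sum>n. ennreal (pi * (cmod (c n))\<^sup>2 / (real n + 1))) = ennreal (integral\<^sup>L lborel ?F)"
    by (intro suminf_ennreal_eq) auto
  moreover have "pi * (cmod (c n))\<^sup>2 / (real n + 1) = pi * (cmod (taylor_coeff h n))\<^sup>2 * (r\<^sup>2) ^ n / (real n + 1)" for n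
    using r by (simp add: c_def norm_mult norm_power power_mult_distrib power_mult[symmetric] mult.commute)
  moreover have "ennreal (?F z) = ennreal ((cmod (h (of_real r * z)))\<^sup>2) * indicator (ball 0 1) z" for z
    by (auto simp: indicator_def)
  ultimately show ?thesis
    using F_int by simp
qed

text \<open>
  Both sides for the dilations \<open>h(r z)\<close>, multiplied by \<open>r\<^sup>2\<close>, increase with \<open>r\<close>. By monotone convergence
  the formula holds for \<open>r = 1\<close> in the extended nonnegative reals, also when the integral diverges.
\<close>

lemma disc_parseval:
  assumes h: "h holomorphic_on ball 0 1"
  shows "(\<integral>\<^sup>+z\<in>ball 0 1. ennreal ((cmod (h z))\<^sup>2) \<partial>lborel)
    = (\<Sum>n. ennreal (pi * (cmod (taylor_coeff h n))\<^sup>2 / (real n + 1)))"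
proof -
  \<comment> \<open>The shift by 2 keeps the radii positive, as the scaling lemma requires.\<close>
  define r where "r k = 1 - 1 / (real k + 2)" for k
  define F where "F z = ennreal ((cmod (h z))\<^sup>2) * indicator (ball 0 1) z" for z
  have r: "0 < r k" "r k < 1" for k by (auto simp: r_def field_simps)
  have r_mono: "r k \<le> r l" if "k \<le> l" for k l
    using that by (auto simp: r_def intro!: divide_left_mono)
  have r_lim: "r \<longlonglongrightarrow> 1"
    using LIMSEQ_ignore_initial_segment[OF LIMSEQ_inverse_real_of_nat_add_minus[of 1], of 1]
    by (simp add: r_def[abs_def] inverse_eq_divide add.commute)
  have [measurable]: "ball 0 s \<in> sets (borel :: complex measure)" for s by simp
  have "(\<lambda>z. indicator (ball 0 1) z *\<^sub>R h z) \<in> borel_measurable borel"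
    using h by (intro borel_measurable_continuous_on_indicator holomorphic_on_imp_continuous_on) auto
  then have "(\<lambda>z. ennreal ((cmod (indicator (ball 0 1) z *\<^sub>R h z))\<^sup>2)) \<in> borel_measurable borel"
    by measurable
  also have "(\<lambda>z. ennreal ((cmod (indicator (ball 0 1) z *\<^sub>R h z))\<^sup>2)) = F"
    by (auto simp: F_def indicator_def)
  finally have [measurable]: "F \<in> borel_measurable borel" .
  have rz: "of_real (r k) * z \<in> ball 0 1" if "z \<in> ball 0 1" for z :: complex and k
  proof -
    have "cmod (of_real (r k) * z) < 1 * 1"
      unfolding norm_mult using r[of k] that by (intro mult_strict_mono) auto
    then show ?thesis by simp
  qed
  have int_r: "(\<integral>\<^sup>+z\<in>ball 0 (r k). F z \<partial>lborel)
      = (\<Sum>n. ennreal (pi * (cmod (taylor_coeff h n))\<^sup>2 / (real n + 1) * (r k) ^ (2 * Suc n)))" for k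
  proof -
    have "(\<integral>\<^sup>+z\<in>ball 0 (r k). F z \<partial>lborel)
       = ennreal ((r k)\<^sup>2) * (\<integral>\<^sup>+z\<in>ball 0 1. F (of_real (r k) * z) \<partial>lborel)"
      by (rule nn_integral_ball_scale) (use r in auto)
    also have "(\<integral>\<^sup>+z\<in>ball 0 1. F (of_real (r k) * z) \<partial>lborel)
       = (\<integral>\<^sup>+z\<in>ball 0 1. ennreal ((cmod (h (of_real (r k) * z)))\<^sup>2) \<partial>lborel)"
      using rz by (intro nn_integral_cong) (auto simp: F_def indicator_def)
    also have "\<dots> = (\<Sum>n. ennreal (pi * (cmod (taylor_coeff h n))\<^sup>2 * ((r k)\<^sup>2) ^ n / (real n + 1)))"
      by (rule disc_dilation_parseval[OF h r])
    finally show ?thesis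
      by (simp add: ennreal_suminf_cmult[symmetric] ennreal_mult'[symmetric] power_mult mult_ac power2_eq_square power_mult_distrib)
  qed
  have inc: "incseq (\<lambda>k. ennreal (pi * (cmod (taylor_coeff h n))\<^sup>2 / (real n + 1) * (r k) ^ (2 * Suc n)))" for n
    unfolding incseq_def
    by (intro allI impI ennreal_leI mult_left_mono power_mono r_mono)
      (use r in \<open>auto simp: less_imp_le\<close>)
  have ind_SUP: "(SUP k. F z * indicator (ball 0 (r k)) z) = F z" for z
  proof (cases "z \<in> ball 0 1")
    case True
    then have "eventually (\<lambda>k. cmod z < r k) sequentially"
      using order_tendstoD(1)[OF r_lim] by simp
    then obtain k where k: "cmod z < r k" by (auto dest: eventually_happens)
    show ?thesis
    proof (rule antisym)
      show "(SUP k. F z * indicator (ball 0 (r k)) z) \<le> F z"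
        by (intro SUP_least) (auto simp: indicator_def)
      show "F z \<le> (SUP k. F z * indicator (ball 0 (r k)) z)"
        by (rule SUP_upper2[of k]) (use k in auto)
    qed
  qed (simp add: F_def)
  have SUP_eq: "(SUP k. ennreal (pi * (cmod (taylor_coeff h n))\<^sup>2 / (real n + 1) * (r k) ^ (2 * Suc n)))
      = ennreal (pi * (cmod (taylor_coeff h n))\<^sup>2 / (real n + 1))" for n
  proof (rule LIMSEQ_unique[OF LIMSEQ_SUP])
    show "incseq (\<lambda>k. ennreal (pi * (cmod (taylor_coeff h n))\<^sup>2 / (real n + 1) * (r k) ^ (2 * Suc n)))"
      by (rule inc)
    have "(\<lambda>k. pi * (cmod (taylor_coeff h n))\<^sup>2 / (real n + 1) * (r k) ^ (2 * Suc n))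
       \<longlonglongrightarrow> pi * (cmod (taylor_coeff h n))\<^sup>2 / (real n + 1) * 1 ^ (2 * Suc n)"
      by (intro tendsto_intros r_lim)
    then show "(\<lambda>k. ennreal (pi * (cmod (taylor_coeff h n))\<^sup>2 / (real n + 1) * (r k) ^ (2 * Suc n)))
       \<longlonglongrightarrow> ennreal (pi * (cmod (taylor_coeff h n))\<^sup>2 / (real n + 1))"
      by (intro tendsto_ennrealI) simp
  qed
  have "(\<integral>\<^sup>+z. F z \<partial>lborel) = (SUP k. \<integral>\<^sup>+z\<in>ball 0 (r k). F z \<partial>lborel)"
  proof -
    have "incseq (\<lambda>k z. F z * indicator (ball 0 (r k)) z)"
      using r_mono by (auto simp: incseq_def le_fun_def indicator_def intro: less_le_trans)
    then have "(\<integral>\<^sup>+z. (SUP k. F z * indicator (ball 0 (r k)) z) \<partial>lborel)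
        = (SUP k. \<integral>\<^sup>+z\<in>ball 0 (r k). F z \<partial>lborel)"
      by (rule nn_integral_monotone_convergence_SUP) measurable
    then show ?thesis by (simp only: ind_SUP)
  qed
  also have "\<dots> = (SUP k. \<Sum>n. ennreal (pi * (cmod (taylor_coeff h n))\<^sup>2 / (real n + 1) * (r k) ^ (2 * Suc n)))"
    by (simp add: int_r)
  also have "\<dots> = (\<Sum>n. SUP k. ennreal (pi * (cmod (taylor_coeff h n))\<^sup>2 / (real n + 1) * (r k) ^ (2 * Suc n)))"
    by (rule ennreal_suminf_SUP_eq[symmetric, OF inc])
  also have "\<dots> = (\<Sum>n. ennreal (pi * (cmod (taylor_coeff h n))\<^sup>2 / (real n + 1)))"
    by (simp only: SUP_eq)
  finally show ?thesis
    by (simp add: F_def)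
qed

section \<open>The Dirichlet space in terms of Taylor coefficients\<close>

lemma power_series_disc:
  assumes "\<And>z. z \<in> ball 0 1 \<Longrightarrow> (\<lambda>n. c n * z ^ n) sums f z"
  shows "f holomorphic_on ball 0 1" and "taylor_coeff f = c"
proof -
  show "f holomorphic_on ball 0 1"
    using assms by (intro power_series_holomorphic[of 0 1 c f]) auto
  \<comment> \<open>Any point of the disc other than the origin shows that the radius of convergence is positive.\<close>
  have "ereal (cmod (1 / 2)) \<le> conv_radius c"
    using assms[of "1 / 2"] by (intro conv_radius_geI) (auto simp: sums_iff)
  moreover have "0 < ereal (cmod (1 / 2))"
    by simp
  ultimately have rad: "fps_conv_radius (Abs_fps c) > 0"
    by (simp add: fps_conv_radius_def less_le_trans[of 0 "ereal (1 / 2)"])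
  have "eventually (\<lambda>z::complex. z \<in> ball 0 1) (nhds 0)"
    by (intro eventually_nhds_in_open) auto
  then have "eventually (\<lambda>z. eval_fps (Abs_fps c) z = f z) (nhds 0)"
    by eventually_elim (use assms in \<open>auto simp: eval_fps_def sums_iff\<close>)
  with rad have "f has_fps_expansion Abs_fps c"
    by (simp add: has_fps_expansion_def)
  from fps_nth_fps_expansion[OF this] show "taylor_coeff f = c"
    by (simp add: taylor_coeff_def fun_eq_iff)
qed

lemma taylor_coeff_linear_combination:
  assumes "f holomorphic_on ball 0 1" "g holomorphic_on ball 0 1"
  shows "taylor_coeff (\<lambda>z. a * f z + b * g z) = (\<lambda>n. a * taylor_coeff f n + b * taylor_coeff g n)"
proof (rule power_series_disc(2))
  fix z :: complex assume "z \<in> ball 0 1"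
  from sums_add[OF sums_mult[OF taylor_sums[OF assms(1) this], of a]
      sums_mult[OF taylor_sums[OF assms(2) this], of b]]
  show "(\<lambda>n. (a * taylor_coeff f n + b * taylor_coeff g n) * z ^ n) sums (a * f z + b * g z)"
    by (simp add: algebra_simps)
qed

lemma taylor_coeff_deriv: "taylor_coeff (deriv f) n = of_nat (Suc n) * taylor_coeff f (Suc n)"
  by (simp add: taylor_coeff_def funpow_swap1 field_simps del: of_nat_Suc)

lemma deriv_weight:
  "pi * (cmod (taylor_coeff (deriv f) n))\<^sup>2 / (real n + 1)
    = pi * (real (Suc n) * (cmod (taylor_coeff f (Suc n)))\<^sup>2)"
  by (simp add: taylor_coeff_deriv norm_mult power2_eq_square field_simps del: of_nat_Suc)
    (simp add: field_simps)

lemma summable_deriv_weights_iff: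
  "summable (\<lambda>n. pi * (cmod (taylor_coeff (deriv f) n))\<^sup>2 / (real n + 1))
    \<longleftrightarrow> summable (\<lambda>n. (real n + 1) * (cmod (taylor_coeff f n))\<^sup>2)"
proof -
  define u where "u n = real n * (cmod (taylor_coeff f n))\<^sup>2" for n
  define v where "v n = (real n + 1) * (cmod (taylor_coeff f n))\<^sup>2" for n
  have "pi * (cmod (taylor_coeff (deriv f) n))\<^sup>2 / (real n + 1) = pi * u (Suc n)" for n
    by (simp only: deriv_weight u_def)
  then have "summable (\<lambda>n. pi * (cmod (taylor_coeff (deriv f) n))\<^sup>2 / (real n + 1)) \<longleftrightarrow> summable u"
    by (simp add: summable_Suc_iff[of u, symmetric])
  also have "\<dots> \<longleftrightarrow> summable v"
  proof
    assume "summable v"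
    then show "summable u"
      by (rule summable_comparison_test'[of _ 0]) (auto simp: u_def v_def intro!: mult_right_mono)
  next
    assume "summable u"
    then have "summable (\<lambda>n. 2 * u n)" by (rule summable_mult)
    then show "summable v"
    proof (rule summable_comparison_test'[of _ 1])
      fix n :: nat assume "1 \<le> n"
      then have "(real n + 1) * (cmod (taylor_coeff f n))\<^sup>2 \<le> (2 * real n) * (cmod (taylor_coeff f n))\<^sup>2"
        by (intro mult_right_mono) auto
      then show "norm (v n) \<le> 2 * u n"
        by (simp add: u_def v_def)
    qed
  qed
  finally show ?thesis by (simp only: v_def[abs_def])
qed

lemma set_integrable_disc_square_iff:
  assumes h: "h holomorphic_on ball 0 1"
  shows "set_integrable lborel (ball 0 1) (\<lambda>z. (cmod (h z))\<^sup>2)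
    \<longleftrightarrow> summable (\<lambda>n. pi * (cmod (taylor_coeff h n))\<^sup>2 / (real n + 1))"
    (is "?I \<longleftrightarrow> ?S")
  and "set_integrable lborel (ball 0 1) (\<lambda>z. (cmod (h z))\<^sup>2) \<Longrightarrow>
    (\<lambda>n. pi * (cmod (taylor_coeff h n))\<^sup>2 / (real n + 1)) sums (LINT z:ball 0 1|lborel. (cmod (h z))\<^sup>2)"
proof -
  let ?F = "\<lambda>z. indicator (ball 0 1) z *\<^sub>R (cmod (h z))\<^sup>2"
  let ?a = "\<lambda>n. pi * (cmod (taylor_coeff h n))\<^sup>2 / (real n + 1)"
  have "(\<lambda>z. indicator (ball 0 1) z *\<^sub>R (cmod (h z))\<^sup>2) \<in> borel_measurable borel"
    using h by (intro borel_measurable_continuous_on_indicator continuous_intros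
        holomorphic_on_imp_continuous_on) auto
  then have meas: "?F \<in> borel_measurable lborel" by simp
  have nn: "(\<integral>\<^sup>+z. ennreal (?F z) \<partial>lborel) = (\<Sum>n. ennreal (?a n))"
    unfolding disc_parseval[OF h, symmetric]
    by (intro nn_integral_cong) (auto simp: indicator_def)
  have pos: "0 \<le> ?a n" for n by simp
  have "?I \<longleftrightarrow> (\<Sum>n. ennreal (?a n)) < top"
    unfolding set_integrable_def nn[symmetric]
    using meas by (subst integrable_iff_bounded) auto
  moreover have "(\<Sum>n. ennreal (?a n)) < top \<longleftrightarrow> ?S"
  proof
    assume "(\<Sum>n. ennreal (?a n)) < top"
    then show ?S
      using summable_suminf_not_top[of ?a, OF pos] by (simp only: less_top)
  next
    assume ?S
    then show "(\<Sum>n. ennreal (?a n)) < top"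
      by (simp only: suminf_ennreal2[of ?a, OF pos] ennreal_less_top)
  qed
  ultimately show eq: "?I \<longleftrightarrow> ?S" by simp
  assume I: ?I
  then have S: ?S using eq by simp
  have "ennreal (LINT z:ball 0 1|lborel. (cmod (h z))\<^sup>2) = (\<integral>\<^sup>+z. ennreal (?F z) \<partial>lborel)"
    using I unfolding set_integrable_def set_lebesgue_integral_def
    by (intro nn_integral_eq_integral[symmetric]) auto
  also have "\<dots> = ennreal (suminf ?a)"
    unfolding nn by (rule suminf_ennreal2) (use S in auto)
  finally have "(LINT z:ball 0 1|lborel. (cmod (h z))\<^sup>2) = suminf ?a"
    using S by (subst (asm) ennreal_inj)
      (auto intro!: suminf_nonneg integral_nonneg_AE simp: set_lebesgue_integral_def)
  then show "?a sums (LINT z:ball 0 1|lborel. (cmod (h z))\<^sup>2)"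
    using S by (simp add: sums_iff)
qed

lemma dirichlet_space_iff:
  "f \<in> dirichlet_space \<longleftrightarrow> f holomorphic_on ball 0 1 \<and> (\<forall>z. z \<notin> ball 0 1 \<longrightarrow> f z = 0) \<and>
     summable (\<lambda>n. (real n + 1) * (cmod (taylor_coeff f n))\<^sup>2)"
proof (cases "f holomorphic_on ball 0 1")
  case True
  then have "deriv f holomorphic_on ball 0 1"
    by (rule holomorphic_deriv) auto
  then show ?thesis
    using True
    by (simp add: dirichlet_space_def set_integrable_disc_square_iff(1) summable_deriv_weights_iff)
qed (simp add: dirichlet_space_def)

lemma dirichlet_energy_sums:
  assumes "f \<in> dirichlet_space"
  shows "(\<lambda>n. real n * (cmod (taylor_coeff f n))\<^sup>2) sums
    ((LINT z:ball 0 1|lborel. (cmod (deriv f z))\<^sup>2) / pi)"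
proof -
  define u where "u n = real n * (cmod (taylor_coeff f n))\<^sup>2" for n
  have "pi * (cmod (taylor_coeff (deriv f) n))\<^sup>2 / (real n + 1) / pi = u (Suc n)" for n
    by (simp only: deriv_weight u_def) simp
  moreover have "deriv f holomorphic_on ball 0 1"
    using assms by (intro holomorphic_deriv) (auto simp: dirichlet_space_def)
  ultimately have "(\<lambda>n. u (Suc n)) sums ((LINT z:ball 0 1|lborel. (cmod (deriv f z))\<^sup>2) / pi)"
    using sums_divide[OF set_integrable_disc_square_iff(2)[of "deriv f"], of pi] assms
    by (simp add: dirichlet_space_def)
  then have "u sums ((LINT z:ball 0 1|lborel. (cmod (deriv f z))\<^sup>2) / pi + u 0)"
    by (rule sums_Suc)
  then show ?thesis
    by (simp add: u_def[abs_def])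
qed

lemma dirichlet_space_summable_hardy:
  "f \<in> dirichlet_space \<Longrightarrow> summable (\<lambda>n. (cmod (taylor_coeff f n))\<^sup>2)"
  unfolding dirichlet_space_iff
  by (rule summable_comparison_test'[of "\<lambda>n. (real n + 1) * (cmod (taylor_coeff f n))\<^sup>2" 0])
    (auto simp: algebra_simps)

lemma dirichlet_norm_sums:
  assumes "f \<in> dirichlet_space"
  shows "(\<lambda>n. (real n + 1) * (cmod (taylor_coeff f n))\<^sup>2) sums (dirichlet_norm f)\<^sup>2"
proof -
  let ?E = "(LINT z:ball 0 1|lborel. (cmod (deriv f z))\<^sup>2) / pi"
  have "?E \<ge> 0"
    unfolding set_lebesgue_integral_def by (intro divide_nonneg_pos integral_nonneg_AE) auto
  moreover have "(\<Sum>n. (cmod (taylor_coeff f n))\<^sup>2) \<ge> 0"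
    using dirichlet_space_summable_hardy[OF assms] by (intro suminf_nonneg) auto
  ultimately have "(dirichlet_norm f)\<^sup>2 = ?E + (\<Sum>n. (cmod (taylor_coeff f n))\<^sup>2)"
    by (simp add: dirichlet_norm_def)
  then show ?thesis
    using sums_add[OF dirichlet_energy_sums[OF assms]
        summable_sums[OF dirichlet_space_summable_hardy[OF assms]]]
    by (simp add: algebra_simps)
qed

lemma dirichlet_norm_nonneg: "f \<in> dirichlet_space \<Longrightarrow> dirichlet_norm f \<ge> 0"
  unfolding dirichlet_norm_def set_lebesgue_integral_def
  using dirichlet_space_summable_hardy[of f]
  by (intro real_sqrt_ge_zero add_nonneg_nonneg suminf_nonneg divide_nonneg_pos integral_nonneg_AE) auto

lemma dirichlet_space_linear_combination:
  assumes f: "f \<in> dirichlet_space" and g: "g \<in> dirichlet_space"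
  shows "(\<lambda>z. a * f z + b * g z) \<in> dirichlet_space"
  unfolding dirichlet_space_iff
proof (intro conjI)
  have hol: "f holomorphic_on ball 0 1" "g holomorphic_on ball 0 1"
    using f g by (auto simp: dirichlet_space_def)
  show "(\<lambda>z. a * f z + b * g z) holomorphic_on ball 0 1"
    using hol by (intro holomorphic_intros)
  show "\<forall>z. z \<notin> ball 0 1 \<longrightarrow> a * f z + b * g z = 0"
    using f g by (auto simp: dirichlet_space_def)
  let ?x = "\<lambda>n. cmod (taylor_coeff f n)" and ?y = "\<lambda>n. cmod (taylor_coeff g n)"
  have "summable (\<lambda>n. 2 * (cmod a)\<^sup>2 * ((real n + 1) * (?x n)\<^sup>2) + 2 * (cmod b)\<^sup>2 * ((real n + 1) * (?y n)\<^sup>2))"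
    using f g by (intro summable_add summable_mult) (auto simp: dirichlet_space_iff)
  then show "summable (\<lambda>n. (real n + 1) * (cmod (taylor_coeff (\<lambda>z. a * f z + b * g z) n))\<^sup>2)"
  proof (rule summable_comparison_test'[of _ 0])
    fix n :: nat
    let ?s = "cmod a * ?x n" and ?t = "cmod b * ?y n"
    have "(cmod (a * taylor_coeff f n + b * taylor_coeff g n))\<^sup>2 \<le> (?s + ?t)\<^sup>2"
      by (intro power_mono norm_triangle_le) (auto simp: norm_mult)
    also have "\<dots> \<le> 2 * ?s\<^sup>2 + 2 * ?t\<^sup>2"
      using sum_squares_bound[of ?s ?t] by (simp add: power2_sum)
    finally have "(real n + 1) * (cmod (a * taylor_coeff f n + b * taylor_coeff g n))\<^sup>2
        \<le> (real n + 1) * (2 * ?s\<^sup>2 + 2 * ?t\<^sup>2)"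
      by (intro mult_left_mono) auto
    then show "norm ((real n + 1) * (cmod (taylor_coeff (\<lambda>z. a * f z + b * g z) n))\<^sup>2)
      \<le> 2 * (cmod a)\<^sup>2 * ((real n + 1) * (?x n)\<^sup>2) + 2 * (cmod b)\<^sup>2 * ((real n + 1) * (?y n)\<^sup>2)"
      by (simp add: taylor_coeff_linear_combination[OF hol] power_mult_distrib algebra_simps)
  qed
qed

lemma
  assumes f: "f \<in> dirichlet_space" and g: "g \<in> dirichlet_space"
  shows dirichlet_space_add: "f + g \<in> dirichlet_space"
    and dirichlet_space_diff: "f - g \<in> dirichlet_space"
    and taylor_coeff_add: "taylor_coeff (f + g) = (\<lambda>n. taylor_coeff f n + taylor_coeff g n)"
    and taylor_coeff_diff: "taylor_coeff (f - g) = (\<lambda>n. taylor_coeff f n - taylor_coeff g n)"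
proof -
  have hol: "f holomorphic_on ball 0 1" "g holomorphic_on ball 0 1"
    using f g by (auto simp: dirichlet_space_def)
  show "f + g \<in> dirichlet_space" "f - g \<in> dirichlet_space"
    using dirichlet_space_linear_combination[OF f g, of 1 1]
      dirichlet_space_linear_combination[OF f g, of 1 "-1"]
    by (simp_all add: plus_fun_def fun_diff_def)
  show "taylor_coeff (f + g) = (\<lambda>n. taylor_coeff f n + taylor_coeff g n)"
    "taylor_coeff (f - g) = (\<lambda>n. taylor_coeff f n - taylor_coeff g n)"
    using taylor_coeff_linear_combination[OF hol, of 1 1]
      taylor_coeff_linear_combination[OF hol, of 1 "-1"]
    by (simp_all add: plus_fun_def fun_diff_def)
qed

lemma
  assumes f: "f \<in> dirichlet_space"
  shows dirichlet_space_scale: "(\<lambda>z. c * f z) \<in> dirichlet_space"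
    and taylor_coeff_scale: "taylor_coeff (\<lambda>z. c * f z) = (\<lambda>n. c * taylor_coeff f n)"
  using dirichlet_space_linear_combination[OF f f, of c 0]
    taylor_coeff_linear_combination[of f f c 0] f
  by (simp_all add: dirichlet_space_def)

text \<open>
  All four terms have the shape \<open>1 * a + c * b\<close>, the linear combinations \<open>1 * f z + c * g z\<close> for which
  the energy is known.
\<close>

lemma polarization:
  fixes a b :: complex
  shows "a * cnj b = (of_real ((cmod (1 * a + 1 * b))\<^sup>2) - of_real ((cmod (1 * a + (-1) * b))\<^sup>2)
    + \<i> * of_real ((cmod (1 * a + \<i> * b))\<^sup>2) - \<i> * of_real ((cmod (1 * a + (-\<i>) * b))\<^sup>2)) / 4"
  unfolding complex_norm_square by (simp add: algebra_simps)

text \<open>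
  The formulas for the inner product and for the norm differ only by polarization, which holds for the
  area integrals and for the Taylor coefficients alike.
\<close>

lemma dirichlet_inner_sums:
  assumes f: "f \<in> dirichlet_space" and g: "g \<in> dirichlet_space"
  shows "(\<lambda>n. of_nat (n + 1) * taylor_coeff f n * cnj (taylor_coeff g n)) sums dirichlet_inner f g"
proof -
  have hol: "f holomorphic_on ball 0 1" "g holomorphic_on ball 0 1"
    using f g by (auto simp: dirichlet_space_def)
  define E where "E b = (LINT z:ball 0 1|lborel. (cmod (deriv (\<lambda>z. 1 * f z + b * g z) z))\<^sup>2)" for b
  have deriv_eq: "deriv (\<lambda>z. 1 * f z + b * g z) z = 1 * deriv f z + b * deriv g z" if "z \<in> ball 0 1" for b z
  proof -
    have "(f has_field_derivative deriv f z) (at z)" "(g has_field_derivative deriv g z) (at z)"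
      using hol that by (auto intro: holomorphic_derivI)
    then show ?thesis
      by (intro DERIV_imp_deriv DERIV_add DERIV_cmult)
  qed
  have E_eq: "E b = (LINT z:ball 0 1|lborel. (cmod (1 * deriv f z + b * deriv g z))\<^sup>2)" for b
    unfolding E_def by (intro set_lebesgue_integral_cong allI impI) (simp, simp only: deriv_eq simp_thms)
  have E_int: "set_integrable lborel (ball 0 1) (\<lambda>z. (cmod (1 * deriv f z + b * deriv g z))\<^sup>2)" for b
  proof -
    have "set_integrable lborel (ball 0 1) (\<lambda>z. (cmod (deriv (\<lambda>z. 1 * f z + b * g z) z))\<^sup>2)"
      using dirichlet_space_linear_combination[OF f g, of 1 b] by (simp only: dirichlet_space_def mem_Collect_eq)
    also have "?this \<longleftrightarrow> ?thesis"
      by (intro set_integrable_cong refl) (simp only: deriv_eq)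
    finally show ?thesis .
  qed
  have E_sums: "(\<lambda>n. complex_of_real (real n * (cmod (1 * taylor_coeff f n + b * taylor_coeff g n))\<^sup>2))
      sums of_real (E b / pi)" for b
    using dirichlet_energy_sums[OF dirichlet_space_linear_combination[OF f g, of 1 b]]
    by (simp only: sums_of_real_iff E_def taylor_coeff_linear_combination[OF hol])
  have E_int': "set_integrable lborel (ball 0 1) (\<lambda>z. complex_of_real ((cmod (1 * deriv f z + b * deriv g z))\<^sup>2))" for b
    using E_int[of b] unfolding set_integrable_def scaleR_conv_of_real of_real_mult[symmetric] 
    by (simp only: integrable_of_real of_real_eq_id id_apply)
  have "(LINT z:ball 0 1|lborel. deriv f z * cnj (deriv g z)) =
      (of_real (E 1) - of_real (E (-1)) + \<i> * of_real (E \<i>) - \<i> * of_real (E (-\<i>))) / 4"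
    by (subst polarization)
      (simp only: set_integral_divide_zero set_integral_diff(2) set_integral_add(2) E_eq E_int'
        set_integral_diff(1) set_integral_add(1) set_integrable_mult_right
        set_integral_mult_right set_integral_complex_of_real)
  moreover have "(of_real (E 1 / pi) - of_real (E (-1) / pi) + \<i> * of_real (E \<i> / pi) - \<i> * of_real (E (-\<i>) / pi)) / 4
      = (of_real (E 1) - of_real (E (-1)) + \<i> * of_real (E \<i>) - \<i> * of_real (E (-\<i>))) / 4 / complex_of_real pi"
    by (simp add: add_divide_distrib diff_divide_distrib mult.commute)
  moreover have "(\<lambda>n. of_nat n * (taylor_coeff f n * cnj (taylor_coeff g n))) sums
      ((of_real (E 1 / pi) - of_real (E (-1) / pi) + \<i> * of_real (E \<i> / pi) - \<i> * of_real (E (-\<i>) / pi)) / 4)"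
  proof -
    let ?N = "\<lambda>b n. complex_of_real (real n * (cmod (1 * taylor_coeff f n + b * taylor_coeff g n))\<^sup>2)"
    have "of_nat n * (taylor_coeff f n * cnj (taylor_coeff g n))
        = (?N 1 n - ?N (-1) n + \<i> * ?N \<i> n - \<i> * ?N (-\<i>) n) / 4" for n
      unfolding polarization[of "taylor_coeff f n"] of_real_mult of_real_of_nat_eq
      by (simp only: times_divide_eq_right distrib_left right_diff_distrib mult.left_commute)
    then show ?thesis
      by (simp only:) (intro sums_divide sums_diff sums_add sums_mult E_sums)
  qed
  ultimately have energy: "(\<lambda>n. of_nat n * (taylor_coeff f n * cnj (taylor_coeff g n))) sums
      ((LINT z:ball 0 1|lborel. deriv f z * cnj (deriv g z)) / of_real pi)"
    by (simp only:)
  have "summable (\<lambda>n. taylor_coeff f n * cnj (taylor_coeff g n))"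
  proof (rule summable_comparison_test'[of _ 0])
    show "summable (\<lambda>n. (cmod (taylor_coeff f n))\<^sup>2 + (cmod (taylor_coeff g n))\<^sup>2)"
      by (intro summable_add dirichlet_space_summable_hardy f g)
    fix n
    show "norm (taylor_coeff f n * cnj (taylor_coeff g n)) \<le> (cmod (taylor_coeff f n))\<^sup>2 + (cmod (taylor_coeff g n))\<^sup>2"
      using sum_squares_bound[of "cmod (taylor_coeff f n)" "cmod (taylor_coeff g n)"]
        mult_nonneg_nonneg[OF norm_ge_zero[of "taylor_coeff f n"] norm_ge_zero[of "taylor_coeff g n"]]
      unfolding norm_mult complex_mod_cnj mult.assoc by linarith
  qed
  from sums_add[OF summable_sums[OF this] energy] show ?thesis
    unfolding dirichlet_inner_def by (simp add: algebra_simps)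
qed

section \<open>Inner product, metric and polynomial approximation\<close>

lemma dirichlet_space_eqI:
  assumes f: "f \<in> dirichlet_space" and g: "g \<in> dirichlet_space"
    and eq: "\<And>n. taylor_coeff f n = taylor_coeff g n"
  shows "f = g"
proof
  fix z
  show "f z = g z"
  proof (cases "z \<in> ball 0 1")
    case True
    have "(\<lambda>n. taylor_coeff g n * z ^ n) sums f z"
      using taylor_sums[OF _ True, of f] f by (simp add: dirichlet_space_def eq)
    moreover have "(\<lambda>n. taylor_coeff g n * z ^ n) sums g z"
      using taylor_sums[OF _ True, of g] g by (simp add: dirichlet_space_def)
    ultimately show ?thesis by (rule sums_unique2)
  qed (use f g in \<open>auto simp: dirichlet_space_def\<close>)
qed

definition disc_series :: "(nat \<Rightarrow> complex) \<Rightarrow> complex \<Rightarrow> complex" where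
  "disc_series c z = (if z \<in> ball 0 1 then \<Sum>n. c n * z ^ n else 0)"

text \<open>
  The Riesz--Fischer property of the Dirichlet space: every admissible coefficient sequence occurs.
\<close>

lemma
  assumes "summable (\<lambda>n. (real n + 1) * (cmod (c n))\<^sup>2)"
  shows disc_series_in_dirichlet_space: "disc_series c \<in> dirichlet_space"
    and taylor_coeff_disc_series: "taylor_coeff (disc_series c) = c"
proof -
  have "summable (\<lambda>n. (cmod (c n))\<^sup>2)"
    by (rule summable_comparison_test'[OF assms, of 0]) (auto simp: algebra_simps)
  then have "Bseq (\<lambda>n. (cmod (c n))\<^sup>2)"
    by (intro convergent_imp_Bseq) (auto dest: summable_LIMSEQ_zero simp: convergent_def)
  then obtain K where K: "\<And>n. (cmod (c n))\<^sup>2 \<le> K" "K > 0"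
    by (auto simp: Bseq_def)
  have sums: "(\<lambda>n. c n * z ^ n) sums disc_series c z" if "z \<in> ball 0 1" for z
  proof -
    have "summable (\<lambda>n. c n * z ^ n)"
    proof (rule summable_comparison_test'[of _ 0])
      show "summable (\<lambda>n. sqrt K * cmod z ^ n)"
        using that by (intro summable_mult summable_geometric) auto
      fix n
      have "cmod (c n) \<le> sqrt K"
        by (rule real_le_rsqrt) (rule K)
      then show "norm (c n * z ^ n) \<le> sqrt K * cmod z ^ n"
        by (simp add: norm_mult norm_power mult_right_mono)
    qed
    then show ?thesis
      using that by (simp add: disc_series_def summable_sums)
  qed
  from power_series_disc[OF sums] have
    hol: "disc_series c holomorphic_on ball 0 1" and coeff: "taylor_coeff (disc_series c) = c"
    by blast+
  show "taylor_coeff (disc_series c) = c" by (rule coeff)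
  show "disc_series c \<in> dirichlet_space"
    unfolding dirichlet_space_iff coeff using hol assms by (simp add: disc_series_def)
qed

definition disc_polynomial :: "(nat \<Rightarrow> complex) \<Rightarrow> nat \<Rightarrow> complex \<Rightarrow> complex" where
  "disc_polynomial c N = disc_series (\<lambda>n. if n < N then c n else 0)"

lemma
  shows disc_polynomial_in_dirichlet_space: "disc_polynomial c N \<in> dirichlet_space"
    and taylor_coeff_disc_polynomial: "taylor_coeff (disc_polynomial c N) n = (if n < N then c n else 0)"
proof -
  have "summable (\<lambda>n. (real n + 1) * (cmod (if n < N then c n else 0))\<^sup>2)"
    by (rule summable_finite[of "{..<N}"]) auto
  note disc_series_in_dirichlet_space[OF this] taylor_coeff_disc_series[OF this]
  then show "disc_polynomial c N \<in> dirichlet_space"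
    "taylor_coeff (disc_polynomial c N) n = (if n < N then c n else 0)"
    by (simp_all add: disc_polynomial_def)
qed

lemma
  shows disc_monomial_in_dirichlet_space: "disc_monomial k \<in> dirichlet_space"
    and taylor_coeff_disc_monomial: "taylor_coeff (disc_monomial k) n = (if n = k then 1 else 0)"
proof -
  have "(\<lambda>n. (if n = k then 1 else 0) * z ^ n) sums disc_monomial k z" if "z \<in> ball 0 1" for z
  proof -
    have "(\<lambda>n. (if n = k then 1 else 0) * z ^ n) = (\<lambda>n. if n = k then z ^ n else 0)"
      by auto
    then show ?thesis
      using sums_single[of k "\<lambda>n. z ^ n"] that by (simp add: disc_monomial_def)
  qed
  from power_series_disc[OF this] have hol: "disc_monomial k holomorphic_on ball 0 1"
    and coeff: "taylor_coeff (disc_monomial k) = (\<lambda>n. if n = k then 1 else 0)" by blast+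
  show "taylor_coeff (disc_monomial k) n = (if n = k then 1 else 0)" by (simp add: coeff)
  have "summable (\<lambda>n. (real n + 1) * (cmod (if n = k then 1 else 0))\<^sup>2)"
    by (rule summable_finite[of "{k}"]) auto
  then show "disc_monomial k \<in> dirichlet_space"
    unfolding dirichlet_space_iff coeff using hol by (simp add: disc_monomial_def)
qed

lemma disc_polynomial_0: "disc_polynomial c 0 = (\<lambda>z. 0)"
  by (simp add: disc_polynomial_def disc_series_def fun_eq_iff)

lemma disc_polynomial_Suc:
  "disc_polynomial c (Suc N) = disc_polynomial c N + (\<lambda>z. c N * disc_monomial N z)"
  by (rule dirichlet_space_eqI)
    (auto simp: disc_polynomial_in_dirichlet_space dirichlet_space_add dirichlet_space_scale
      disc_monomial_in_dirichlet_space taylor_coeff_disc_polynomial taylor_coeff_add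
      taylor_coeff_scale taylor_coeff_disc_monomial less_Suc_eq)

lemma dirichlet_norm_LIMSEQ:
  assumes "f \<in> dirichlet_space"
  shows "(\<lambda>N. L2_set (\<lambda>n. sqrt (real n + 1) * cmod (taylor_coeff f n)) {..<N}) \<longlonglongrightarrow> dirichlet_norm f"
proof -
  have "(\<lambda>N. sqrt (\<Sum>n<N. (real n + 1) * (cmod (taylor_coeff f n))\<^sup>2)) \<longlonglongrightarrow> sqrt ((dirichlet_norm f)\<^sup>2)"
    using dirichlet_norm_sums[OF assms] by (intro tendsto_real_sqrt) (simp add: sums_def)
  then show ?thesis
    using dirichlet_norm_nonneg[OF assms] by (simp add: L2_set_def power_mult_distrib)
qed

lemma dirichlet_norm_power2_eq:
  assumes "f \<in> dirichlet_space" "(\<lambda>n. (real n + 1) * (cmod (taylor_coeff f n))\<^sup>2) sums s"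
  shows "(dirichlet_norm f)\<^sup>2 = s"
  using dirichlet_norm_sums[OF assms(1)] assms(2) by (rule sums_unique2)

lemma taylor_coeff_le_dirichlet_norm:
  assumes "f \<in> dirichlet_space"
  shows "cmod (taylor_coeff f n) \<le> dirichlet_norm f"
proof (rule power2_le_imp_le)
  have "(cmod (taylor_coeff f n))\<^sup>2 \<le> (real n + 1) * (cmod (taylor_coeff f n))\<^sup>2"
    by (simp add: algebra_simps)
  also have "\<dots> = (\<Sum>k\<in>{n}. (real k + 1) * (cmod (taylor_coeff f k))\<^sup>2)"
    by simp
  also have "\<dots> \<le> (\<Sum>k. (real k + 1) * (cmod (taylor_coeff f k))\<^sup>2)"
    by (intro sum_le_suminf sums_summable[OF dirichlet_norm_sums[OF assms]]) auto
  also have "\<dots> = (dirichlet_norm f)\<^sup>2"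
    by (rule sums_unique[symmetric, OF dirichlet_norm_sums[OF assms]])
  finally show "(cmod (taylor_coeff f n))\<^sup>2 \<le> (dirichlet_norm f)\<^sup>2" .
qed (rule dirichlet_norm_nonneg[OF assms])

lemma dirichlet_norm_add_le:
  assumes f: "f \<in> dirichlet_space" and g: "g \<in> dirichlet_space"
  shows "dirichlet_norm (f + g) \<le> dirichlet_norm f + dirichlet_norm g"
proof (rule LIMSEQ_le[OF dirichlet_norm_LIMSEQ[OF dirichlet_space_add[OF f g]]
      tendsto_add[OF dirichlet_norm_LIMSEQ[OF f] dirichlet_norm_LIMSEQ[OF g]]], intro exI allI impI)
  fix N :: nat
  have "L2_set (\<lambda>n. sqrt (real n + 1) * cmod (taylor_coeff (f + g) n)) {..<N}
     \<le> L2_set (\<lambda>n. sqrt (real n + 1) * cmod (taylor_coeff f n) + sqrt (real n + 1) * cmod (taylor_coeff g n)) {..<N}"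
    by (intro L2_set_mono)
      (auto simp: taylor_coeff_add[OF f g] norm_triangle_ineq simp flip: distrib_left intro!: mult_left_mono)
  also have "\<dots> \<le> L2_set (\<lambda>n. sqrt (real n + 1) * cmod (taylor_coeff f n)) {..<N}
      + L2_set (\<lambda>n. sqrt (real n + 1) * cmod (taylor_coeff g n)) {..<N}"
    by (rule L2_set_triangle_ineq)
  finally show "L2_set (\<lambda>n. sqrt (real n + 1) * cmod (taylor_coeff (f + g) n)) {..<N} \<le> \<dots>" .
qed

lemma dirichlet_norm_diff_commute:
  assumes "f \<in> dirichlet_space" "g \<in> dirichlet_space"
  shows "dirichlet_norm (f - g) = dirichlet_norm (g - f)"
proof -
  have "(\<lambda>n. (real n + 1) * (cmod (taylor_coeff (f - g) n))\<^sup>2) sums (dirichlet_norm (g - f))\<^sup>2"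
    using dirichlet_norm_sums[OF dirichlet_space_diff[OF assms(2,1)]]
    by (simp only: taylor_coeff_diff assms norm_minus_commute)
  then have "(dirichlet_norm (f - g))\<^sup>2 = (dirichlet_norm (g - f))\<^sup>2"
    by (intro dirichlet_norm_power2_eq dirichlet_space_diff assms)
  then show ?thesis
    using assms by (simp add: dirichlet_norm_nonneg dirichlet_space_diff)
qed

lemma dirichlet_norm_eq_0_iff:
  assumes "f \<in> dirichlet_space"
  shows "dirichlet_norm f = 0 \<longleftrightarrow> f = (\<lambda>z. 0)"
proof
  assume "dirichlet_norm f = 0"
  then have "taylor_coeff f n = 0" for n
    using taylor_coeff_le_dirichlet_norm[OF assms, of n] by simp
  then show "f = (\<lambda>z. 0)"
    using disc_polynomial_in_dirichlet_space[of "\<lambda>_. 0" 0] assms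
    by (intro dirichlet_space_eqI)
      (auto simp: taylor_coeff_disc_polynomial simp flip: disc_polynomial_0[of "\<lambda>_. 0"])
next
  assume "f = (\<lambda>z. 0)"
  then show "dirichlet_norm f = 0"
    using dirichlet_norm_sums[OF assms] taylor_coeff_disc_polynomial[of "\<lambda>_. 0" 0]
    by (auto simp: disc_polynomial_0 dest: sums_unique2[OF sums_zero])
qed

lemma dirichlet_Metric_space: "Metric_space dirichlet_space dirichlet_dist"
proof
  fix f g h :: "complex \<Rightarrow> complex"
  show "0 \<le> dirichlet_dist f g"
    by (simp add: dirichlet_dist_def dirichlet_norm_nonneg dirichlet_space_diff)
  show "dirichlet_dist f g = dirichlet_dist g f"
    by (simp add: dirichlet_dist_def dirichlet_norm_diff_commute)
  assume f: "f \<in> dirichlet_space" and g: "g \<in> dirichlet_space"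
  show "dirichlet_dist f g = 0 \<longleftrightarrow> f = g"
    using f g by (auto simp: dirichlet_dist_def dirichlet_norm_eq_0_iff dirichlet_space_diff fun_eq_iff)
  assume h: "h \<in> dirichlet_space"
  show "dirichlet_dist f h \<le> dirichlet_dist f g + dirichlet_dist g h"
    using dirichlet_norm_add_le[OF dirichlet_space_diff[OF f g] dirichlet_space_diff[OF g h]] f g h
    by (simp add: dirichlet_dist_def)
qed

lemma dirichlet_inner_linear_combination:
  assumes f: "f \<in> dirichlet_space" and g: "g \<in> dirichlet_space" and h: "h \<in> dirichlet_space"
  shows "dirichlet_inner (\<lambda>z. a * f z + b * g z) h = a * dirichlet_inner f h + b * dirichlet_inner g h"
proof -
  have hol: "f holomorphic_on ball 0 1" "g holomorphic_on ball 0 1"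
    using f g by (auto simp: dirichlet_space_def)
  have "(\<lambda>n. of_nat (n + 1) * taylor_coeff (\<lambda>z. a * f z + b * g z) n * cnj (taylor_coeff h n))
     sums (a * dirichlet_inner f h + b * dirichlet_inner g h)"
    using sums_add[OF sums_mult[OF dirichlet_inner_sums[OF f h], of a] sums_mult[OF dirichlet_inner_sums[OF g h], of b]]
    by (simp add: taylor_coeff_linear_combination[OF hol] algebra_simps)
  then show ?thesis
    using dirichlet_inner_sums[OF dirichlet_space_linear_combination[OF f g] h] sums_unique2 by blast
qed

lemma dirichlet_inner_monomial:
  assumes "g \<in> dirichlet_space"
  shows "dirichlet_inner (disc_monomial n) g = of_nat (n + 1) * cnj (taylor_coeff g n)"
proof -
  have "(\<lambda>k. of_nat (k + 1) * taylor_coeff (disc_monomial n) k * cnj (taylor_coeff g k))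
     = (\<lambda>k. if k = n then of_nat (k + 1) * cnj (taylor_coeff g k) else 0)"
    by (auto simp: taylor_coeff_disc_monomial)
  then show ?thesis
    using dirichlet_inner_sums[OF disc_monomial_in_dirichlet_space assms, of n]
      sums_single[of n "\<lambda>k. of_nat (k + 1) * cnj (taylor_coeff g k)"]
    by (simp only:) (rule sums_unique2)
qed

lemma dirichlet_cauchy_schwarz:
  assumes f: "f \<in> dirichlet_space" and g: "g \<in> dirichlet_space"
  shows "cmod (dirichlet_inner f g) \<le> dirichlet_norm f * dirichlet_norm g"
proof (rule LIMSEQ_le[OF tendsto_norm[OF dirichlet_inner_sums[OF f g, unfolded sums_def]]
      tendsto_mult[OF dirichlet_norm_LIMSEQ[OF f] dirichlet_norm_LIMSEQ[OF g]]], intro exI allI impI)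
  fix N :: nat
  have "cmod (\<Sum>n<N. of_nat (n + 1) * taylor_coeff f n * cnj (taylor_coeff g n))
    \<le> (\<Sum>n<N. \<bar>sqrt (real n + 1) * cmod (taylor_coeff f n)\<bar> * \<bar>sqrt (real n + 1) * cmod (taylor_coeff g n)\<bar>)"
  proof (rule sum_norm_le)
    fix n
    have "norm (of_nat (n + 1) * taylor_coeff f n * cnj (taylor_coeff g n))
       = (sqrt (real n + 1) * sqrt (real n + 1)) * cmod (taylor_coeff f n) * cmod (taylor_coeff g n)"
      unfolding norm_mult norm_of_nat complex_mod_cnj by simp
    also have "\<dots> = \<bar>sqrt (real n + 1) * cmod (taylor_coeff f n)\<bar> * \<bar>sqrt (real n + 1) * cmod (taylor_coeff g n)\<bar>"
      by (simp only: abs_mult abs_norm_cancel abs_of_nonneg[OF real_sqrt_ge_zero] of_nat_0_le_iff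
          add_nonneg_nonneg zero_le_one mult_ac)
    finally show "norm (of_nat (n + 1) * taylor_coeff f n * cnj (taylor_coeff g n)) \<le> \<dots>" by simp
  qed
  also have "\<dots> \<le> L2_set (\<lambda>n. sqrt (real n + 1) * cmod (taylor_coeff f n)) {..<N}
      * L2_set (\<lambda>n. sqrt (real n + 1) * cmod (taylor_coeff g n)) {..<N}"
    by (rule L2_set_mult_ineq)
  finally show "cmod (\<Sum>n<N. of_nat (n + 1) * taylor_coeff f n * cnj (taylor_coeff g n)) \<le> \<dots>" .
qed

lemma disc_polynomial_approximates:
  assumes f: "f \<in> dirichlet_space"
  shows "(\<lambda>N. dirichlet_norm (f - disc_polynomial (taylor_coeff f) N)) \<longlonglongrightarrow> 0"
proof -
  define w where "w n = (real n + 1) * (cmod (taylor_coeff f n))\<^sup>2" for n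
  have w: "w sums (dirichlet_norm f)\<^sup>2"
    using dirichlet_norm_sums[OF f] by (simp add: w_def[abs_def])
  have norm_eq: "dirichlet_norm (f - disc_polynomial (taylor_coeff f) N) = sqrt ((dirichlet_norm f)\<^sup>2 - (\<Sum>n<N. w n))" for N
  proof -
    let ?h = "f - disc_polynomial (taylor_coeff f) N"
    have h: "?h \<in> dirichlet_space"
      using f by (simp add: dirichlet_space_diff disc_polynomial_in_dirichlet_space)
    have "(\<lambda>n. w n - (if n \<in> {..<N} then w n else 0)) sums ((dirichlet_norm f)\<^sup>2 - (\<Sum>n\<in>{..<N}. w n))"
      by (intro sums_diff w sums_If_finite_set) auto
    moreover have "(\<lambda>n. w n - (if n \<in> {..<N} then w n else 0)) = (\<lambda>n. (real n + 1) * (cmod (taylor_coeff ?h n))\<^sup>2)"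
      using f by (auto simp: taylor_coeff_diff disc_polynomial_in_dirichlet_space taylor_coeff_disc_polynomial w_def)
    ultimately have "(dirichlet_norm ?h)\<^sup>2 = (dirichlet_norm f)\<^sup>2 - (\<Sum>n<N. w n)"
      by (intro dirichlet_norm_power2_eq[OF h]) simp
    then have "sqrt ((dirichlet_norm ?h)\<^sup>2) = sqrt ((dirichlet_norm f)\<^sup>2 - (\<Sum>n<N. w n))"
      by simp
    then show ?thesis
      using dirichlet_norm_nonneg[OF h] by simp
  qed
  have "(\<lambda>N. sqrt ((dirichlet_norm f)\<^sup>2 - (\<Sum>n<N. w n))) \<longlonglongrightarrow> sqrt ((dirichlet_norm f)\<^sup>2 - (dirichlet_norm f)\<^sup>2)"
    using w by (intro tendsto_intros) (simp add: sums_def)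
  then show ?thesis
    by (simp add: norm_eq)
qed

section \<open>Adjoints of bounded operators\<close>

lemma bounded_operator_polynomial:
  assumes T: "bounded_operator T" and g: "g \<in> dirichlet_space"
  shows "dirichlet_inner (T (disc_polynomial a N)) g = (\<Sum>n<N. a n * dirichlet_inner (T (disc_monomial n)) g)"
proof (induction N)
  case 0
  have "T (\<lambda>z. 0 * disc_monomial 0 z) = (\<lambda>z. 0 * T (disc_monomial 0) z)"
    using T disc_monomial_in_dirichlet_space unfolding bounded_operator_def by blast
  then have "T (disc_polynomial a 0) = (\<lambda>z. 0)"
    by (simp add: disc_polynomial_0)
  then show ?case
    using dirichlet_inner_linear_combination[OF g g g, of 0 0] by simp
next
  case (Suc N)
  have P: "disc_polynomial a N \<in> dirichlet_space" and M: "disc_monomial N \<in> dirichlet_space"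
    by (rule disc_polynomial_in_dirichlet_space disc_monomial_in_dirichlet_space)+
  have TP: "T (disc_polynomial a N) \<in> dirichlet_space" and TM: "T (disc_monomial N) \<in> dirichlet_space"
    using T P M unfolding bounded_operator_def by auto
  have "T (disc_polynomial a (Suc N)) = T (disc_polynomial a N) + T (\<lambda>z. a N * disc_monomial N z)"
    using T P dirichlet_space_scale[OF M] unfolding disc_polynomial_Suc bounded_operator_def by blast
  also have "T (\<lambda>z. a N * disc_monomial N z) = (\<lambda>z. a N * T (disc_monomial N) z)"
    using T M unfolding bounded_operator_def by blast
  finally have "T (disc_polynomial a (Suc N)) = (\<lambda>z. 1 * T (disc_polynomial a N) z + a N * T (disc_monomial N) z)"
    by (simp add: plus_fun_def)
  then show ?case
    using Suc.IH dirichlet_inner_linear_combination[OF TP TM g, of 1 "a N"] by simp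
qed

text \<open>
  If \<open>S\<close> is the adjoint, the coefficients of \<open>S g\<close> must be \<open>c\<^sub>n = cnj \<langle>T z\<^sup>n, g\<rangle> / (n + 1)\<close>. That they
  belong to an element of the Dirichlet space follows by testing \<open>T\<close> on the partial sums
  \<open>h = \<Sum>\<^sub>n\<^sub><\<^sub>N c\<^sub>n z\<^sup>n\<close>: as \<open>\<parallel>h\<parallel>\<^sup>2 = \<langle>T h, g\<rangle> \<le> C \<parallel>h\<parallel> \<parallel>g\<parallel>\<close>, the norms of these sums are
  bounded by \<open>C \<parallel>g\<parallel>\<close>. The defining identity then holds on polynomials, and extends by
  continuity.
\<close>

lemma bounded_operator_adjoint_exists:
  assumes T: "bounded_operator T"
  shows "\<exists>S. is_adjoint T S"
proof -
  obtain C where C: "\<And>f. f \<in> dirichlet_space \<Longrightarrow> dirichlet_norm (T f) \<le> C * dirichlet_norm f"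
    using T unfolding bounded_operator_def by blast
  have TD: "T f \<in> dirichlet_space" if "f \<in> dirichlet_space" for f
    using T that unfolding bounded_operator_def by auto
  define c where "c g n = cnj (dirichlet_inner (T (disc_monomial n)) g) / of_nat (n + 1)" for g n
  have inner_c: "dirichlet_inner (T (disc_monomial n)) g = of_nat (n + 1) * cnj (c g n)" for g n
    by (simp add: c_def field_simps del: of_nat_Suc)
  have c_summable: "summable (\<lambda>n. (real n + 1) * (cmod (c g n))\<^sup>2)" if g: "g \<in> dirichlet_space" for g
  proof (rule summableI_nonneg_bounded)
    fix N
    let ?s = "\<Sum>n<N. (real n + 1) * (cmod (c g n))\<^sup>2" and ?h = "disc_polynomial (c g) N"
    have h: "?h \<in> dirichlet_space" by (rule disc_polynomial_in_dirichlet_space)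
    have "(\<lambda>n. if n \<in> {..<N} then (real n + 1) * (cmod (c g n))\<^sup>2 else 0) sums (\<Sum>n\<in>{..<N}. (real n + 1) * (cmod (c g n))\<^sup>2)"
      by (intro sums_If_finite_set) auto
    also have "(\<lambda>n. if n \<in> {..<N} then (real n + 1) * (cmod (c g n))\<^sup>2 else 0) = (\<lambda>n. (real n + 1) * (cmod (taylor_coeff ?h n))\<^sup>2)"
      by (auto simp: taylor_coeff_disc_polynomial)
    finally have s_norm: "?s = (dirichlet_norm ?h)\<^sup>2"
      by (rule dirichlet_norm_power2_eq[OF h, symmetric])
    have s0: "?s \<ge> 0" by (intro sum_nonneg) auto
    have "dirichlet_inner (T ?h) g = of_real ?s"
      unfolding bounded_operator_polynomial[OF T g] inner_c of_real_sum
      by (intro sum.cong refl) (simp add: complex_norm_square[unfolded of_real_power] mult_ac add.commute)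
    then have "?s = cmod (dirichlet_inner (T ?h) g)"
      using s0 by (simp only: norm_of_real abs_of_nonneg)
    also have "\<dots> \<le> dirichlet_norm (T ?h) * dirichlet_norm g"
      by (rule dirichlet_cauchy_schwarz[OF TD[OF h] g])
    also have "\<dots> \<le> (C * dirichlet_norm ?h) * dirichlet_norm g"
      by (intro mult_right_mono C h dirichlet_norm_nonneg g)
    finally have "dirichlet_norm ?h * dirichlet_norm ?h \<le> (C * dirichlet_norm g) * dirichlet_norm ?h"
      unfolding s_norm by (simp add: power2_eq_square mult_ac)
    then have "dirichlet_norm ?h \<le> C * dirichlet_norm g \<or> dirichlet_norm ?h = 0"
      using dirichlet_norm_nonneg[OF h] by (auto simp: mult_le_cancel_right)
    then have "(dirichlet_norm ?h)\<^sup>2 \<le> (C * dirichlet_norm g)\<^sup>2"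
      using dirichlet_norm_nonneg[OF h] by (auto intro: power_mono)
    then show "?s \<le> (C * dirichlet_norm g)\<^sup>2"
      unfolding s_norm .
  qed auto
  have SD: "disc_series (c g) \<in> dirichlet_space" and coeff: "taylor_coeff (disc_series (c g)) = c g"
    if "g \<in> dirichlet_space" for g
    using disc_series_in_dirichlet_space taylor_coeff_disc_series c_summable[OF that] by blast+
  have "dirichlet_inner (T f) g = dirichlet_inner f (disc_series (c g))"
    if f: "f \<in> dirichlet_space" and g: "g \<in> dirichlet_space" for f g
  proof -
    let ?f = "disc_polynomial (taylor_coeff f)"
    have fN: "?f N \<in> dirichlet_space" for N by (rule disc_polynomial_in_dirichlet_space)
    have "(\<lambda>N. dirichlet_inner (T (?f N)) g) \<longlonglongrightarrow> dirichlet_inner (T f) g"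
    proof (rule LIM_zero_cancel, rule Lim_null_comparison)
      show "(\<lambda>N. C * dirichlet_norm (f - ?f N) * dirichlet_norm g) \<longlonglongrightarrow> 0"
        by (intro tendsto_mult_left_zero tendsto_mult_right_zero disc_polynomial_approximates f)
      show "\<forall>\<^sub>F N in sequentially. norm (dirichlet_inner (T (?f N)) g - dirichlet_inner (T f) g)
          \<le> C * dirichlet_norm (f - ?f N) * dirichlet_norm g"
      proof (rule always_eventually, rule allI)
        fix N
        have d: "f - ?f N \<in> dirichlet_space" by (rule dirichlet_space_diff[OF f fN])
        have "T f = T ((f - ?f N) + ?f N)" by simp
        also have "\<dots> = T (f - ?f N) + T (?f N)"
          using T d fN unfolding bounded_operator_def by blast
        finally have "T f = (\<lambda>z. 1 * T (f - ?f N) z + 1 * T (?f N) z)"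
          by (simp add: plus_fun_def)
        then have "dirichlet_inner (T f) g = dirichlet_inner (T (f - ?f N)) g + dirichlet_inner (T (?f N)) g"
          using dirichlet_inner_linear_combination[OF TD[OF d] TD[OF fN] g, of 1 1] by simp
        then have "norm (dirichlet_inner (T (?f N)) g - dirichlet_inner (T f) g) = cmod (dirichlet_inner (T (f - ?f N)) g)"
          by simp
        also have "\<dots> \<le> dirichlet_norm (T (f - ?f N)) * dirichlet_norm g"
          by (rule dirichlet_cauchy_schwarz[OF TD[OF d] g])
        also have "\<dots> \<le> C * dirichlet_norm (f - ?f N) * dirichlet_norm g"
          by (intro mult_right_mono C d dirichlet_norm_nonneg g)
        finally show "norm (dirichlet_inner (T (?f N)) g - dirichlet_inner (T f) g)
          \<le> C * dirichlet_norm (f - ?f N) * dirichlet_norm g" .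
      qed
    qed
    moreover have "dirichlet_inner (T (?f N)) g = (\<Sum>n<N. of_nat (n + 1) * taylor_coeff f n * cnj (taylor_coeff (disc_series (c g)) n))" for N
      unfolding bounded_operator_polynomial[OF T g] inner_c coeff[OF g] by (simp add: mult_ac)
    ultimately show ?thesis
      using dirichlet_inner_sums[OF f SD[OF g]] LIMSEQ_unique unfolding sums_def by force
  qed
  then have "is_adjoint T (\<lambda>g. disc_series (c g))"
    using SD unfolding is_adjoint_def by auto
  then show ?thesis by blast
qed

section \<open>Functions with Taylor coefficients in one residue class\<close>

definition coefficient_subspace :: "nat \<Rightarrow> nat \<Rightarrow> (complex \<Rightarrow> complex) set" where
  "coefficient_subspace q j = {f \<in> dirichlet_space. \<forall>n. n mod q \<noteq> j \<longrightarrow> taylor_coeff f n = 0}"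

lemma taylor_coeff_zero: "taylor_coeff (\<lambda>z. 0) n = 0"
  using taylor_coeff_disc_polynomial[of "\<lambda>_. 0" 0 n] by (simp add: disc_polynomial_0)

lemma zero_in_dirichlet_space: "(\<lambda>z. 0) \<in> dirichlet_space"
  using disc_polynomial_in_dirichlet_space[of "\<lambda>_. 0" 0] by (simp add: disc_polynomial_0)

lemma coefficient_subspace_subspace: "cfun_subspace (coefficient_subspace q j)"
  unfolding cfun.subspace_def coefficient_subspace_def
  by (auto simp: dirichlet_space_add dirichlet_space_scale taylor_coeff_add taylor_coeff_scale
      zero_fun_def taylor_coeff_zero zero_in_dirichlet_space)

lemma disc_monomial_in_coefficient_subspace: "disc_monomial n \<in> coefficient_subspace q (n mod q)"
  by (auto simp: coefficient_subspace_def disc_monomial_in_dirichlet_space taylor_coeff_disc_monomial)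

lemma disc_polynomial_in_span:
  assumes "\<And>n. n mod q \<noteq> j \<Longrightarrow> c n = 0"
  shows "disc_polynomial c N \<in> cfun_span (range (\<lambda>k. disc_monomial (k * q + j)))"
proof (induction N)
  case 0
  show ?case
    using cfun.span_zero by (simp add: disc_polynomial_0 zero_fun_def)
next
  case (Suc N)
  have "(\<lambda>z. c N * disc_monomial N z) \<in> cfun_span (range (\<lambda>k. disc_monomial (k * q + j)))"
  proof (cases "N mod q = j")
    case True
    then have "disc_monomial N = disc_monomial (N div q * q + j)"
      by auto
    then show ?thesis
      by (metis cfun.span_scale cfun.span_base rangeI)
  next
    case False
    then show ?thesis
      using cfun.span_zero assms by (simp add: zero_fun_def)
  qed
  then show ?case
    unfolding disc_polynomial_Suc by (intro cfun.span_add Suc.IH)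
qed

text \<open>
  Taylor coefficients are continuous in the Dirichlet norm, so the closure of the span has no others;
  conversely the Taylor polynomials of a function converge to it in norm.
\<close>

lemma monomial_subspace_eq:
  assumes "j < q"
  shows "monomial_subspace q j = coefficient_subspace q j"
proof -
  interpret Metric_space dirichlet_space dirichlet_dist
    by (rule dirichlet_Metric_space)
  let ?S = "cfun_span (range (\<lambda>k. disc_monomial (k * q + j)))"
  have span: "?S \<subseteq> coefficient_subspace q j"
  proof (rule cfun.span_minimal[OF _ coefficient_subspace_subspace])
    show "range (\<lambda>k. disc_monomial (k * q + j)) \<subseteq> coefficient_subspace q j"
      using disc_monomial_in_coefficient_subspace[of _ q] assms
      by (metis (no_types, lifting) image_subsetI mod_less mod_mult_self3)
  qed
  have "monomial_subspace q j = {f \<in> dirichlet_space. \<forall>r>0. \<exists>g\<in>?S. g \<in> mball f r}"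
    by (simp add: monomial_subspace_def dirichlet_topology_def metric_closure_of)
  also have "\<dots> = coefficient_subspace q j"
  proof (intro set_eqI iffI)
    fix f assume "f \<in> {f \<in> dirichlet_space. \<forall>r>0. \<exists>g\<in>?S. g \<in> mball f r}"
    then have f: "f \<in> dirichlet_space" and approx: "\<And>r. r > 0 \<Longrightarrow> \<exists>g\<in>?S. g \<in> mball f r"
      by auto
    have "taylor_coeff f n = 0" if n: "n mod q \<noteq> j" for n
    proof (rule ccontr)
      assume "taylor_coeff f n \<noteq> 0"
      then obtain g where g: "g \<in> ?S" "g \<in> mball f (cmod (taylor_coeff f n))"
        using approx[of "cmod (taylor_coeff f n)"] by auto
      then have gD: "g \<in> dirichlet_space" and "taylor_coeff g n = 0"
        using span n by (auto simp: coefficient_subspace_def)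
      then have "cmod (taylor_coeff f n) = cmod (taylor_coeff (f - g) n)"
        by (simp add: taylor_coeff_diff f)
      also have "\<dots> \<le> dirichlet_norm (f - g)"
        by (intro taylor_coeff_le_dirichlet_norm dirichlet_space_diff f gD)
      also have "\<dots> < cmod (taylor_coeff f n)"
        using g(2) f gD by (simp add: dirichlet_dist_def)
      finally show False by simp
    qed
    with f show "f \<in> coefficient_subspace q j"
      by (simp add: coefficient_subspace_def)
  next
    fix f assume f: "f \<in> coefficient_subspace q j"
    then have fD: "f \<in> dirichlet_space" by (simp add: coefficient_subspace_def)
    have "\<exists>g\<in>?S. g \<in> mball f r" if r: "r > 0" for r
    proof -
      have "eventually (\<lambda>N. dirichlet_norm (f - disc_polynomial (taylor_coeff f) N) < r) sequentially"
        using order_tendstoD(2)[OF disc_polynomial_approximates[OF fD] r] .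
      then obtain N where "dirichlet_norm (f - disc_polynomial (taylor_coeff f) N) < r"
        by (auto dest: eventually_happens)
      moreover have "disc_polynomial (taylor_coeff f) N \<in> ?S"
        using f by (intro disc_polynomial_in_span) (simp add: coefficient_subspace_def)
      ultimately show ?thesis
        using fD disc_polynomial_in_dirichlet_space by (auto simp: dirichlet_dist_def)
    qed
    with fD show "f \<in> {f \<in> dirichlet_space. \<forall>r>0. \<exists>g\<in>?S. g \<in> mball f r}"
      by auto
  qed
  finally show ?thesis .
qed

text \<open>
  For \<open>n\<close> outside the residue class \<open>j\<close>, the function \<open>T z\<^sup>n\<close> has its coefficients in another residue
  class, so \<open>\<langle>z\<^sup>n, S g\<rangle> = \<langle>T z\<^sup>n, g\<rangle> = 0\<close>.
\<close>

lemma adjoint_preserves_coefficient_subspace: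
  assumes S: "is_adjoint T S"
    and T: "\<And>j. j < q \<Longrightarrow> T ` coefficient_subspace q j \<subseteq> coefficient_subspace q j"
    and j: "j < q"
  shows "S ` coefficient_subspace q j \<subseteq> coefficient_subspace q j"
proof (rule image_subsetI)
  fix g assume g: "g \<in> coefficient_subspace q j"
  then have gD: "g \<in> dirichlet_space" by (simp add: coefficient_subspace_def)
  have Sg: "S g \<in> dirichlet_space" using S gD by (auto simp: is_adjoint_def)
  have "taylor_coeff (S g) n = 0" if n: "n mod q \<noteq> j" for n
  proof -
    have Te: "T (disc_monomial n) \<in> coefficient_subspace q (n mod q)"
      using T[of "n mod q"] j disc_monomial_in_coefficient_subspace[of n q] by auto
    then have TeD: "T (disc_monomial n) \<in> dirichlet_space"
      by (simp add: coefficient_subspace_def)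
    have "taylor_coeff (T (disc_monomial n)) k = 0 \<or> taylor_coeff g k = 0" for k
      using Te g n by (cases "k mod q = j") (auto simp: coefficient_subspace_def)
    then have "(\<lambda>k. of_nat (k + 1) * taylor_coeff (T (disc_monomial n)) k * cnj (taylor_coeff g k)) = (\<lambda>k. 0)"
      by (auto simp: fun_eq_iff)
    then have "dirichlet_inner (T (disc_monomial n)) g = 0"
      using dirichlet_inner_sums[OF TeD gD] sums_unique2[OF sums_zero] by metis
    then have "dirichlet_inner (disc_monomial n) (S g) = 0"
      using S gD disc_monomial_in_dirichlet_space by (simp add: is_adjoint_def)
    then have "of_nat (n + 1) * cnj (taylor_coeff (S g) n) = 0"
      by (simp only: dirichlet_inner_monomial[OF Sg])
    then show ?thesis
      by (simp del: of_nat_Suc)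
  qed
  with Sg show "S g \<in> coefficient_subspace q j"
    by (simp add: coefficient_subspace_def)
qed

text \<open>
  With \<open>w = exp(2 \<pi> i / q)\<close>, the coefficients of \<open>f(w z)\<close> are \<open>w\<^sup>n f\<^sub>n\<close>, and \<open>w\<^sup>n = w\<^sup>j\<close> exactly when
  \<open>n\<close> is congruent to \<open>j\<close>. Stating membership as a functional equation makes it obvious how it
  behaves under multiplication by a function of \<open>z\<^sup>q\<close>.
\<close>

lemma coefficient_subspace_iff_rotation:
  assumes f: "f \<in> dirichlet_space" and j: "j < q"
  shows "f \<in> coefficient_subspace q j \<longleftrightarrow>
    (\<forall>z\<in>ball 0 1. f (cis (2 * pi / q) * z) = cis (2 * pi / q) ^ j * f z)"
proof -
  define w where "w = cis (2 * pi / q)"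
  have [simp]: "cmod w = 1" by (simp add: w_def)
  have hol: "f holomorphic_on ball 0 1" using f by (simp add: dirichlet_space_def)
  have wq: "w ^ q = 1"
    using j by (simp add: w_def Complex.DeMoivre)
  have w_mod: "w ^ n = w ^ (n mod q)" for n
  proof -
    have "w ^ n = w ^ (n div q * q + n mod q)" by simp
    also have "\<dots> = w ^ (n mod q)"
      unfolding power_add mult.commute[of "n div q"] power_mult wq by simp
    finally show ?thesis .
  qed
  have w_eq: "w ^ n = w ^ j \<longleftrightarrow> n mod q = j" for n
  proof
    assume "w ^ n = w ^ j"
    then have "w ^ (n mod q) = w ^ j" using w_mod[of n] by simp
    then have "cis (2 * pi * real (n mod q) / real q) = cis (2 * pi * real j / real q)"
      by (simp add: w_def Complex.DeMoivre mult_ac)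
    moreover have "inj_on (\<lambda>k. cis (2 * pi * real k / real q)) {..<q}"
      using Complex.bij_betw_roots_unity[of q] j by (simp add: bij_betw_def)
    ultimately show "n mod q = j"
      using j by (auto dest: inj_onD)
  qed (use w_mod[of n] in simp)
  have wz: "w * z \<in> ball 0 1" if "z \<in> ball 0 1" for z
    using that by (simp add: norm_mult)
  have rot: "(\<lambda>n. w ^ n * taylor_coeff f n * z ^ n) sums f (w * z)" if "z \<in> ball 0 1" for z
    using taylor_sums[OF hol wz[OF that]] by (simp add: power_mult_distrib mult_ac)
  have scaled: "(\<lambda>n. w ^ j * taylor_coeff f n * z ^ n) sums (w ^ j * f z)" if "z \<in> ball 0 1" for z
    using sums_mult[OF taylor_sums[OF hol that], of "w ^ j"] by (simp add: mult_ac)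
  have "f \<in> coefficient_subspace q j \<longleftrightarrow> (\<forall>n. w ^ n * taylor_coeff f n = w ^ j * taylor_coeff f n)"
    using f w_eq by (auto simp: coefficient_subspace_def)
  also have "\<dots> \<longleftrightarrow> (\<forall>z\<in>ball 0 1. f (w * z) = w ^ j * f z)"
  proof
    assume eq: "\<forall>n. w ^ n * taylor_coeff f n = w ^ j * taylor_coeff f n"
    show "\<forall>z\<in>ball 0 1. f (w * z) = w ^ j * f z"
      using rot scaled sums_unique2 by (simp only: eq) blast
  next
    assume eq: "\<forall>z\<in>ball 0 1. f (w * z) = w ^ j * f z"
    have "taylor_coeff (\<lambda>z. w ^ j * f z) = (\<lambda>n. w ^ n * taylor_coeff f n)"
      using rot eq by (intro power_series_disc(2)) metis
    moreover have "taylor_coeff (\<lambda>z. w ^ j * f z) = (\<lambda>n. w ^ j * taylor_coeff f n)"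
      by (rule taylor_coeff_scale[OF f])
    ultimately show "\<forall>n. w ^ n * taylor_coeff f n = w ^ j * taylor_coeff f n"
      by metis
  qed
  finally show ?thesis by (simp add: w_def)
qed

section \<open>Multiplication by a bounded function with bounded derivative\<close>

text \<open>
  The derivative is existentially quantified, rather than written with \<^const>\<open>deriv\<close>, so that the
  closure properties below are direct applications of the differentiation rules.
\<close>

definition bounded_with_bounded_deriv :: "(complex \<Rightarrow> complex) \<Rightarrow> bool" where
  "bounded_with_bounded_deriv h \<longleftrightarrow> (\<exists>h' B. \<forall>z\<in>ball 0 1.
     (h has_field_derivative h' z) (at z) \<and> cmod (h z) \<le> B \<and> cmod (h' z) \<le> B)"

lemma bounded_with_bounded_deriv_const: "bounded_with_bounded_deriv (\<lambda>z. c)"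
  unfolding bounded_with_bounded_deriv_def
  by (rule exI[of _ "\<lambda>z. 0"], rule exI[of _ "cmod c"]) auto

lemma bounded_with_bounded_deriv_mult:
  assumes "bounded_with_bounded_deriv f" "bounded_with_bounded_deriv g"
  shows "bounded_with_bounded_deriv (\<lambda>z. f z * g z)"
proof -
  from assms obtain f' A g' B where
    f: "\<And>z. z \<in> ball 0 1 \<Longrightarrow> (f has_field_derivative f' z) (at z) \<and> cmod (f z) \<le> A \<and> cmod (f' z) \<le> A" and
    g: "\<And>z. z \<in> ball 0 1 \<Longrightarrow> (g has_field_derivative g' z) (at z) \<and> cmod (g z) \<le> B \<and> cmod (g' z) \<le> B"
    unfolding bounded_with_bounded_deriv_def by blast
  have A0: "0 \<le> A" and B0: "0 \<le> B"
    using f[of 0] g[of 0] norm_ge_zero[of "f 0"] norm_ge_zero[of "g 0"] by (auto simp del: norm_ge_zero)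
  show ?thesis
    unfolding bounded_with_bounded_deriv_def
  proof (intro exI ballI conjI)
    fix z :: complex assume z: "z \<in> ball 0 1"
    show "((\<lambda>z. f z * g z) has_field_derivative f' z * g z + g' z * f z) (at z)"
      using f[OF z] g[OF z] by (intro DERIV_mult) auto
    have "cmod (f z * g z) \<le> A * B"
      unfolding norm_mult using f[OF z] g[OF z] A0 by (intro mult_mono) auto
    also have "\<dots> \<le> 2 * (A * B)" using A0 B0 by simp
    finally show "cmod (f z * g z) \<le> 2 * (A * B)" .
    have "cmod (f' z * g z + g' z * f z) \<le> A * B + B * A"
      unfolding norm_mult using f[OF z] g[OF z] A0 B0
      by (intro norm_triangle_le add_mono) (auto simp: norm_mult intro!: mult_mono)
    then show "cmod (f' z * g z + g' z * f z) \<le> 2 * (A * B)" by simp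
  qed
qed

lemma bounded_with_bounded_deriv_prod:
  fixes n :: nat
  assumes "\<And>i. i < n \<Longrightarrow> bounded_with_bounded_deriv (h i)"
  shows "bounded_with_bounded_deriv (\<lambda>z. \<Prod>i<n. h i z)"
  using assms
  by (induction n) (auto intro: bounded_with_bounded_deriv_const bounded_with_bounded_deriv_mult)

lemma bounded_with_bounded_deriv_moebius:
  assumes a: "a \<in> ball 0 1"
  shows "bounded_with_bounded_deriv (disc_moebius a)"
proof -
  define d where "d = 1 - cmod a"
  have d: "0 < d" "d \<le> 1" using a by (auto simp: d_def)
  have den: "d \<le> cmod (1 - cnj a * z)" if "z \<in> ball 0 1" for z
  proof -
    have "cmod (cnj a * z) \<le> cmod a * 1"
      using that unfolding norm_mult complex_mod_cnj by (intro mult_left_mono) auto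
    then show ?thesis
      using norm_triangle_ineq2[of 1 "cnj a * z"] by (simp add: d_def)
  qed
  show ?thesis
    unfolding bounded_with_bounded_deriv_def
  proof (intro exI ballI conjI)
    fix z :: complex assume z: "z \<in> ball 0 1"
    note dz = den[OF z]
    have nz: "1 - cnj a * z \<noteq> 0" using dz d by auto
    show "(disc_moebius a has_field_derivative (a * cnj a - 1) / (1 - cnj a * z)\<^sup>2) (at z)"
      unfolding disc_moebius_def[abs_def]
      by (rule derivative_eq_intros refl nz)+ (use nz in \<open>simp add: power2_eq_square field_simps\<close>)
    have d2: "d\<^sup>2 \<le> d" using d by (simp add: power2_eq_square mult_left_le)
    have "cmod (disc_moebius a z) \<le> 2 / d"
      unfolding disc_moebius_def norm_divide
      using a z d dz norm_triangle_ineq4[of a z] by (intro frac_le) auto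
    also have "\<dots> \<le> 2 / d\<^sup>2"
      using d d2 by (intro divide_left_mono) auto
    finally show "cmod (disc_moebius a z) \<le> 2 / d\<^sup>2" .
    have "cmod (a * cnj a) \<le> 1 * 1"
      unfolding norm_mult using a by (intro mult_mono) auto
    then have "cmod (a * cnj a - 1) \<le> 2"
      using norm_triangle_ineq4[of "a * cnj a" 1] by simp
    then show "cmod ((a * cnj a - 1) / (1 - cnj a * z)\<^sup>2) \<le> 2 / d\<^sup>2"
      unfolding norm_divide norm_power using d dz by (intro frac_le power_mono) auto
  qed
qed

lemma bounded_with_bounded_deriv_cong:
  assumes "bounded_with_bounded_deriv f" "\<And>z. z \<in> ball 0 1 \<Longrightarrow> f z = g z"
  shows "bounded_with_bounded_deriv g"
proof -
  from assms(1) obtain f' B where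
    f: "\<And>z. z \<in> ball 0 1 \<Longrightarrow> (f has_field_derivative f' z) (at z) \<and> cmod (f z) \<le> B \<and> cmod (f' z) \<le> B"
    unfolding bounded_with_bounded_deriv_def by blast
  have "(g has_field_derivative f' z) (at z)" if "z \<in> ball 0 1" for z
    by (rule has_field_derivative_transform_within_open[of f, OF _ open_ball that assms(2)])
      (use f[OF that] in auto)
  then show ?thesis
    unfolding bounded_with_bounded_deriv_def using f assms(2) by metis
qed

lemma bounded_with_bounded_deriv_compose_power:
  assumes h: "bounded_with_bounded_deriv h" and q: "q > 0"
  shows "bounded_with_bounded_deriv (\<lambda>z. h (z ^ q))"
proof -
  from h obtain h' B where
    h: "\<And>z. z \<in> ball 0 1 \<Longrightarrow> (h has_field_derivative h' z) (at z) \<and> cmod (h z) \<le> B \<and> cmod (h' z) \<le> B"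
    unfolding bounded_with_bounded_deriv_def by blast
  have B0: "0 \<le> B" using h[of 0] norm_ge_zero[of "h 0"] by (auto simp del: norm_ge_zero)
  show ?thesis
    unfolding bounded_with_bounded_deriv_def
  proof (intro exI ballI conjI)
    fix z :: complex assume z: "z \<in> ball 0 1"
    have zq: "z ^ q \<in> ball 0 1"
      using z q by (simp add: norm_power power_less_one_iff)
    have "((\<lambda>z. z ^ q) has_field_derivative of_nat q * z ^ (q - 1)) (at z)"
      by (auto intro!: derivative_eq_intros)
    then show "((\<lambda>z. h (z ^ q)) has_field_derivative h' (z ^ q) * (of_nat q * z ^ (q - 1))) (at z)"
      using h[OF zq] by (intro DERIV_chain2[where f = h and g = "\<lambda>z. z ^ q"]) auto
    have "B * 1 \<le> B * real q" using q B0 by (intro mult_left_mono) auto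
    then show "cmod (h (z ^ q)) \<le> B * real q" using h[OF zq] by simp
    have "cmod (of_nat q * z ^ (q - 1)) \<le> real q * 1"
      unfolding norm_mult norm_power norm_of_nat using z by (intro mult_left_mono power_le_one) auto
    then show "cmod (h' (z ^ q) * (of_nat q * z ^ (q - 1))) \<le> B * real q"
      unfolding norm_mult[of "h' (z ^ q)"] using h[OF zq] B0 by (intro mult_mono) auto
  qed
qed

text \<open>
  On the disc \<open>(\<phi> f)' = \<phi>' f + \<phi> f'\<close>, and the area integrals of \<open>\<bar>f\<bar>\<^sup>2\<close> and \<open>\<bar>f'\<bar>\<^sup>2\<close> are both
  controlled by the norm of \<open>f\<close>. Since \<open>n + 1 \<le> 2 n\<close> for \<open>n \<ge> 1\<close>, the squared norm of
  \<open>\<phi> f\<close>, including its Hardy space part, is controlled by the constant coefficient and the area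
  integral of the derivative.
\<close>

lemma bounded_operator_mult_op:
  assumes "bounded_with_bounded_deriv \<phi>"
  shows "bounded_operator (mult_op \<phi>)"
proof -
  from assms obtain \<phi>' B where
    \<phi>: "\<And>z. z \<in> ball 0 1 \<Longrightarrow> (\<phi> has_field_derivative \<phi>' z) (at z) \<and> cmod (\<phi> z) \<le> B \<and> cmod (\<phi>' z) \<le> B"
    unfolding bounded_with_bounded_deriv_def by blast
  have B0: "0 \<le> B" using \<phi>[of 0] norm_ge_zero[of "\<phi> 0"] by (auto simp del: norm_ge_zero)
  \<comment> \<open>The square of the norm is at most \<open>B\<^sup>2\<close> for the constant coefficient plus twice \<open>4 B\<^sup>2\<close> for the derivative.\<close>
  define C where "C = sqrt (9 * B\<^sup>2)"
  have key: "mult_op \<phi> f \<in> dirichlet_space \<and> dirichlet_norm (mult_op \<phi> f) \<le> C * dirichlet_norm f"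
    if f: "f \<in> dirichlet_space" for f
  proof -
    let ?g = "mult_op \<phi> f" and ?a = "taylor_coeff f"
    let ?I = "\<lambda>h. (LINT z:ball 0 1|lborel. (cmod (h z))\<^sup>2)"
    let ?N = "(dirichlet_norm f)\<^sup>2"
    have hol: "f holomorphic_on ball 0 1" using f by (simp add: dirichlet_space_def)
    have \<phi>_hol: "\<phi> holomorphic_on ball 0 1"
      using \<phi> by (meson holomorphic_onI field_differentiable_at_within field_differentiable_def)
    have g_hol: "?g holomorphic_on ball 0 1"
      unfolding mult_op_def by (intro holomorphic_intros hol \<phi>_hol)
    then have dg_hol: "deriv ?g holomorphic_on ball 0 1"
      by (rule holomorphic_deriv) auto
    have df_hol: "deriv f holomorphic_on ball 0 1"
      by (rule holomorphic_deriv[OF hol]) auto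
    have df_int: "set_integrable lborel (ball 0 1) (\<lambda>z. (cmod (deriv f z))\<^sup>2)"
      using f by (simp add: dirichlet_space_def)
    have f_le: "pi * (cmod (?a n))\<^sup>2 / (real n + 1) \<le> pi * ((real n + 1) * (cmod (?a n))\<^sup>2)" for n
    proof -
      have "pi * (cmod (?a n))\<^sup>2 / (real n + 1) \<le> pi * (cmod (?a n))\<^sup>2 / 1"
        by (intro divide_left_mono) auto
      also have "\<dots> \<le> pi * ((real n + 1) * (cmod (?a n))\<^sup>2)"
        by (simp add: algebra_simps)
      finally show ?thesis .
    qed
    note f_sums = sums_mult[OF dirichlet_norm_sums[OF f], of pi]
    have f_int: "set_integrable lborel (ball 0 1) (\<lambda>z. (cmod (f z))\<^sup>2)"
      unfolding set_integrable_disc_square_iff(1)[OF hol]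
      by (rule summable_comparison_test'[OF sums_summable[OF f_sums], of 0]) (use f_le in auto)
    have f_bound: "?I f \<le> pi * ?N"
      by (rule sums_le[OF f_le set_integrable_disc_square_iff(2)[OF hol f_int] f_sums])
    have df_bound: "?I (deriv f) \<le> pi * ?N"
    proof -
      have "?I (deriv f) / pi \<le> ?N"
        by (rule sums_le[OF _ dirichlet_energy_sums[OF f] dirichlet_norm_sums[OF f]])
          (auto intro!: mult_right_mono)
      then show ?thesis by (simp add: field_simps)
    qed
    have ptw: "(cmod (deriv ?g z))\<^sup>2 \<le> 2 * B\<^sup>2 * (cmod (f z))\<^sup>2 + 2 * B\<^sup>2 * (cmod (deriv f z))\<^sup>2"
      if z: "z \<in> ball 0 1" for z
    proof -
      have "(f has_field_derivative deriv f z) (at z)"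
        using hol z by (auto intro: holomorphic_derivI)
      then have "deriv ?g z = \<phi>' z * f z + deriv f z * \<phi> z"
        unfolding mult_op_def using \<phi>[OF z] by (intro DERIV_imp_deriv DERIV_mult) auto
      moreover have "cmod (\<phi>' z * f z) \<le> B * cmod (f z)" "cmod (deriv f z * \<phi> z) \<le> B * cmod (deriv f z)"
        using \<phi>[OF z] by (auto simp: norm_mult mult.commute[of "cmod (deriv f z)"] intro!: mult_right_mono)
      ultimately have "cmod (deriv ?g z) \<le> B * cmod (f z) + B * cmod (deriv f z)"
        using norm_triangle_ineq[of "\<phi>' z * f z" "deriv f z * \<phi> z"] by simp
      then have "(cmod (deriv ?g z))\<^sup>2 \<le> (B * cmod (f z) + B * cmod (deriv f z))\<^sup>2"
        by (intro power_mono) auto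
      also have "\<dots> \<le> 2 * (B * cmod (f z))\<^sup>2 + 2 * (B * cmod (deriv f z))\<^sup>2"
        using sum_squares_bound[of "B * cmod (f z)" "B * cmod (deriv f z)"] by (simp add: power2_sum)
      finally show ?thesis by (simp add: power_mult_distrib)
    qed
    have maj: "set_integrable lborel (ball 0 1) (\<lambda>z. 2 * B\<^sup>2 * (cmod (f z))\<^sup>2 + 2 * B\<^sup>2 * (cmod (deriv f z))\<^sup>2)"
      by (intro set_integral_add(1) set_integrable_mult_right f_int df_int)
    have dg_int: "set_integrable lborel (ball 0 1) (\<lambda>z. (cmod (deriv ?g z))\<^sup>2)"
    proof (rule set_integrable_bound[OF maj])
      show "set_borel_measurable lborel (ball 0 1) (\<lambda>z. (cmod (deriv ?g z))\<^sup>2)"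
        unfolding set_borel_measurable_def
        using dg_hol borel_measurable_continuous_on_indicator[of "ball 0 1" "\<lambda>z. (cmod (deriv ?g z))\<^sup>2"]
        by (simp add: continuous_intros holomorphic_on_imp_continuous_on)
      show "AE z in lborel. z \<in> ball 0 1 \<longrightarrow> norm ((cmod (deriv ?g z))\<^sup>2)
          \<le> norm (2 * B\<^sup>2 * (cmod (f z))\<^sup>2 + 2 * B\<^sup>2 * (cmod (deriv f z))\<^sup>2)"
        using ptw by (intro AE_I2) force
    qed
    have gD: "?g \<in> dirichlet_space"
      unfolding dirichlet_space_def using g_hol dg_int f by (simp add: mult_op_def dirichlet_space_def)
    have "?I (deriv ?g) \<le> (LINT z:ball 0 1|lborel. 2 * B\<^sup>2 * (cmod (f z))\<^sup>2 + 2 * B\<^sup>2 * (cmod (deriv f z))\<^sup>2)"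
      by (intro set_integral_mono dg_int maj ptw)
    also have "\<dots> = 2 * B\<^sup>2 * ?I f + 2 * B\<^sup>2 * ?I (deriv f)"
      by (simp only: set_integral_add(2) set_integrable_mult_right f_int df_int set_integral_mult_right)
    also have "\<dots> \<le> 2 * B\<^sup>2 * (pi * ?N) + 2 * B\<^sup>2 * (pi * ?N)"
      by (intro add_mono mult_left_mono f_bound df_bound) auto
    finally have dg_bound: "?I (deriv ?g) / pi \<le> 4 * B\<^sup>2 * ?N"
      by (simp add: field_simps)
    have g0: "(cmod (taylor_coeff ?g 0))\<^sup>2 \<le> B\<^sup>2 * ?N"
    proof -
      have "cmod (taylor_coeff ?g 0) = cmod (\<phi> 0) * cmod (?a 0)"
        by (simp add: taylor_coeff_def mult_op_def norm_mult)
      also have "\<dots> \<le> B * dirichlet_norm f"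
        using \<phi>[of 0] B0 taylor_coeff_le_dirichlet_norm[OF f, of 0] by (intro mult_mono) auto
      finally show ?thesis
        by (metis power_mono power_mult_distrib norm_ge_zero)
    qed
    let ?b = "\<lambda>n. (cmod (taylor_coeff ?g n))\<^sup>2"
    have "(dirichlet_norm ?g)\<^sup>2 \<le> ?b 0 + 2 * (?I (deriv ?g) / pi)"
    proof (rule sums_le[OF _ dirichlet_norm_sums[OF gD]
          sums_add[OF sums_single[of 0 ?b] sums_mult[OF dirichlet_energy_sums[OF gD]]]])
      fix n :: nat
      show "(real n + 1) * ?b n \<le> (if n = 0 then ?b n else 0) + 2 * (real n * ?b n)"
      proof (cases "n = 0")
        case False
        then have "(real n + 1) * ?b n \<le> (2 * real n) * ?b n"
          by (intro mult_right_mono) auto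
        then show ?thesis using False by simp
      qed simp
    qed
    also have "\<dots> \<le> B\<^sup>2 * ?N + 2 * (4 * B\<^sup>2 * ?N)"
      by (intro add_mono mult_left_mono g0 dg_bound) auto
    also have "\<dots> = (C * dirichlet_norm f)\<^sup>2"
      by (simp add: C_def power_mult_distrib)
    finally have "dirichlet_norm ?g \<le> C * dirichlet_norm f"
      by (rule power2_le_imp_le) (simp add: C_def dirichlet_norm_nonneg[OF f])
    with gD show ?thesis by simp
  qed
  then show ?thesis
    unfolding bounded_operator_def
    by (auto simp: mult_op_def fun_eq_iff algebra_simps intro!: exI[of _ C])
qed

lemma finite_blaschke_product_bounded_with_bounded_deriv:
  assumes "finite_blaschke_product n \<psi>"
  shows "bounded_with_bounded_deriv \<psi>"
proof -
  from assms obtain c a where a: "\<And>i. i < n \<Longrightarrow> a i \<in> ball 0 1"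
    and \<psi>: "\<And>z. z \<in> ball 0 1 \<Longrightarrow> \<psi> z = c * (\<Prod>i<n. disc_moebius (a i) z)"
    unfolding finite_blaschke_product_def by blast
  have "bounded_with_bounded_deriv (\<lambda>z. c * (\<Prod>i<n. disc_moebius (a i) z))"
    by (intro bounded_with_bounded_deriv_mult bounded_with_bounded_deriv_const
        bounded_with_bounded_deriv_prod bounded_with_bounded_deriv_moebius a)
  then show ?thesis
    by (rule bounded_with_bounded_deriv_cong) (simp add: \<psi>)
qed

section \<open>Reducing subspaces of the multiplication operator\<close>

theorem mainTheorem6:
  fixes n p q :: nat and \<psi>\<^sub>1 \<phi> :: "complex \<Rightarrow> complex"
  assumes "\<not> prime n" and "n = p * q" and "p > 1" and "q > 1"
    and "finite_blaschke_product p \<psi>\<^sub>1"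
    and "\<And>z. z \<in> ball 0 1 \<Longrightarrow> \<phi> z = \<psi>\<^sub>1 (z ^ q)"
  shows "(\<forall>j<q. reducing_subspace (mult_op \<phi>) (monomial_subspace q j)) \<and>
         reducible (mult_op \<phi>)"
proof -
  have "bounded_with_bounded_deriv (\<lambda>z. \<psi>\<^sub>1 (z ^ q))"
    using assms by (intro bounded_with_bounded_deriv_compose_power finite_blaschke_product_bounded_with_bounded_deriv) auto
  then have "bounded_with_bounded_deriv \<phi>"
    by (rule bounded_with_bounded_deriv_cong) (simp add: assms(6))
  then have bounded: "bounded_operator (mult_op \<phi>)"
    by (rule bounded_operator_mult_op)
  let ?w = "cis (2 * pi / q)"
  have \<phi>_rot: "\<phi> (?w * z) = \<phi> z" if "z \<in> ball 0 1" for z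
  proof -
    have "?w ^ q = 1" using \<open>q > 1\<close> by (simp add: Complex.DeMoivre)
    then have "(?w * z) ^ q = z ^ q" by (simp add: power_mult_distrib)
    then show ?thesis
      using that assms(6)[of z] assms(6)[of "?w * z"] by (simp add: norm_mult)
  qed
  have invariant: "mult_op \<phi> ` coefficient_subspace q j \<subseteq> coefficient_subspace q j" if j: "j < q" for j
  proof (rule image_subsetI)
    fix f assume f: "f \<in> coefficient_subspace q j"
    then have fD: "f \<in> dirichlet_space" by (simp add: coefficient_subspace_def)
    then have gD: "mult_op \<phi> f \<in> dirichlet_space"
      using bounded by (auto simp: bounded_operator_def)
    show "mult_op \<phi> f \<in> coefficient_subspace q j"
      using f unfolding coefficient_subspace_iff_rotation[OF fD j] coefficient_subspace_iff_rotation[OF gD j]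
      by (simp add: mult_op_def \<phi>_rot)
  qed
  obtain S where S: "is_adjoint (mult_op \<phi>) S"
    using bounded_operator_adjoint_exists[OF bounded] by blast
  have reducing: "reducing_subspace (mult_op \<phi>) (monomial_subspace q j)" if j: "j < q" for j
    unfolding reducing_subspace_def
  proof (intro conjI exI)
    show "closedin dirichlet_topology (monomial_subspace q j)"
      unfolding monomial_subspace_def by simp
    show "monomial_subspace q j \<subseteq> dirichlet_space" "cfun_subspace (monomial_subspace q j)"
      "mult_op \<phi> ` monomial_subspace q j \<subseteq> monomial_subspace q j"
      "S ` monomial_subspace q j \<subseteq> monomial_subspace q j"
      unfolding monomial_subspace_eq[OF j]
      using coefficient_subspace_subspace invariant[OF j]
        adjoint_preserves_coefficient_subspace[OF S invariant j]
      by (auto simp: coefficient_subspace_def)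
  qed (rule bounded S)+
  have "disc_monomial 0 \<in> coefficient_subspace q 0" "disc_monomial 1 \<notin> coefficient_subspace q 0"
    using \<open>q > 1\<close> disc_monomial_in_coefficient_subspace[of 0 q]
    by (auto simp: coefficient_subspace_def taylor_coeff_disc_monomial intro!: exI[of _ 1])
  moreover have "disc_monomial 0 \<noteq> 0"
    by (auto simp: disc_monomial_def fun_eq_iff intro!: exI[of _ 0])
  ultimately have "monomial_subspace q 0 \<noteq> {0}" "monomial_subspace q 0 \<noteq> dirichlet_space"
    using \<open>q > 1\<close> disc_monomial_in_dirichlet_space[of 1] by (auto simp: monomial_subspace_eq)
  then have "reducible (mult_op \<phi>)"
    unfolding reducible_def using reducing[of 0] \<open>q > 1\<close> by auto
  with reducing show ?thesis by blast
qed

end
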